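(* Let $K$ be a field of prime characteristic $p$, let $R=K[x_1,\dots,x_n]/I$ be a $0$-dimensional affine $K$-algebra, and let $(f_1,\dots,f_k)\in(R^\times)^k$. Perform the following steps. (1) Compute a quasi-perfect field $L\supseteq K$ for $R$. (2) Compute the maximal ideals $\mathfrak m_1,\dots,\mathfrak m_s$ of $S=L\otimes_KR$. (3) For $i=1,\dots,s$ compute the exponent lattice $\Lambda_i\subseteq\mathbb Z^k$ of $(\overline f_1,\dots,\overline f_k)$, where $\overline f_j$ is the canonical image of $f_j$ in the field $S/\mathfrak m_i$. (4) For $i=1,\dots,k$ let $g_i$ be the canonical image of $f_i$ in $S$, and compute the decomposition $g_i=g_i^{\mathrm{sep}}+g_i^{\mathrm{nil}}$ into separable and nilpotent part. (5) Let $h_i=1+g_i^{\mathrm{nil}}(g_i^{\mathrm{sep}})^{-1}$ and compute the exponent lattice $M\subseteq\mathbb Z^k$ of $(h_1,\dots,h_k)$ in the group $1+\operatorname{Rad}(0)$, where $\operatorname{Rad}(0)$ is the zero radical of $S$. (6) Return the lattice $M\cap\Lambda_1\cap\cdots\cap\Lambda_s$. Then the returned lattice $M\cap\Lambda_1\cap\cdots\cap\Lambda_s$ is the exponent lattice of $(f_1,\dots,f_k)$ in $R$.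
   Context: For elements $f_1,\dots,f_k$ of a multiplicative abelian group $G$, the exponent lattice of $(f_1,\dots,f_k)$ is $\{(a_1,\dots,a_k)\in\mathbb Z^k\mid f_1^{a_1}\cdots f_k^{a_k}=1\}$; for units of a ring $R$ take $G=R^\times$. A polynomial $f\in K[x]$ is separable if it is a non-zero constant or factors over the algebraic closure $\overline K$ into pairwise distinct linear factors. If $f=(x-a_1)^{e_1}\cdots(x-a_r)^{e_r}\in\overline K[x]$ with pairwise distinct $a_i$ and $e_i\ge1$, then $\operatorname{sep}(f)=(x-a_1)\cdots(x-a_r)$ is its separable part. An element $a$ of a $0$-dimensional affine $K$-algebra is separable if its minimal polynomial over $K$ is separable; the separable elements form a $K$-subalgebra $R^{\mathrm{sep}}$. The zero radical $\operatorname{Rad}(0)$ of $R$ is the intersection of all its maximal ideals (equivalently its nilradical). An extension field $L$ of $K$ is a quasi-perfect field for $R=K[x_1,\dots,x_n]/I$ if the radical of $IL[x_1,\dots,x_n]$ remains radical over every extension field of $L$; equivalently, if $\operatorname{sep}(\mu_a)\in L[z]$ for the minimal polynomial $\mu_a\in K[z]$ of every $a\in R$. If the base field $L$ is quasi-perfect for an $L$-algebra $S$, every $a\in S$ has a unique decomposition $a=a^{\mathrm{sep}}+a^{\mathrm{nil}}$ with $a^{\mathrm{sep}}\in S^{\mathrm{sep}}$ (the separable part) and $a^{\mathrm{nil}}\in\operatorname{Rad}(0)$ (the nilpotent part). The set $1+\operatorname{Rad}(0)$ is a subgroup of $S^\times$. *)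

theory Defs
  imports "HOL-Algebra.Algebraic_Closure_Type" "HOL-Algebra.Ideal" "HOL-Algebra.QuotRing"
    "HOL-Algebra.FiniteProduct" "HOL-Library.Poly_Mapping" "HOL-Library.FuncSet"
begin

text \<open>Base fields are types of class \<open>field\<close>; the algebras over them are rings with an explicit
  carrier, together with a structure map from the base field.\<close>

type_synonym 'k mpoly = "(nat \<Rightarrow>\<^sub>0 nat) \<Rightarrow>\<^sub>0 'k"

definition mpoly_ring :: "nat \<Rightarrow> ('k::field) mpoly ring" where
  "mpoly_ring n =
     ring_of_type_algebra\<lparr>carrier := {q. \<forall>m \<in> Poly_Mapping.keys q. Poly_Mapping.keys m \<subseteq> {1..n}}\<rparr>"

text \<open>The structure map of the \<open>K\<close>-algebra \<open>mpoly_ring n Quot I\<close>; the exponent vector \<open>0\<close> is the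
  monomial \<open>1\<close>.\<close>

definition quot_const :: "nat \<Rightarrow> ('k::field) mpoly set \<Rightarrow> 'k \<Rightarrow> 'k mpoly set" where
  "quot_const n I c = I +>\<^bsub>mpoly_ring n\<^esub> (Poly_Mapping.single 0 c)"

text \<open>Krull dimension zero; the zero ring, which has no prime ideals, is admitted.\<close>

definition zero_dimensional :: "('a, 'm) ring_scheme \<Rightarrow> bool" where
  "zero_dimensional R \<longleftrightarrow> (\<forall>P. primeideal P R \<longrightarrow> maximalideal P R)"

definition zero_radical :: "('a, 'm) ring_scheme \<Rightarrow> 'a set" where
  "zero_radical R = {x \<in> carrier R. \<forall>P. maximalideal P R \<longrightarrow> x \<in> P}"

definition one_plus_radical :: "('a, 'm) ring_scheme \<Rightarrow> 'a monoid" where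
  "one_plus_radical R =
     (units_of R)\<lparr>carrier := (\<lambda>r. \<one>\<^bsub>R\<^esub> \<oplus>\<^bsub>R\<^esub> r) ` zero_radical R\<rparr>"

text \<open>\<open>\<int>\<^sup>k\<close> is the set of extensional functions on \<open>{1..k}\<close>.\<close>

definition exponent_lattice :: "('a, 'm) monoid_scheme \<Rightarrow> nat \<Rightarrow> (nat \<Rightarrow> 'a) \<Rightarrow> (nat \<Rightarrow> int) set" where
  "exponent_lattice G k f =
     {a \<in> {1..k} \<rightarrow>\<^sub>E UNIV. (\<Otimes>\<^bsub>G\<^esub>j\<in>{1..k}. f j [^]\<^bsub>G\<^esub> a j) = \<one>\<^bsub>G\<^esub>}"


subsection \<open>Separability\<close>

definition alg_eval ::
  "('a, 'm) ring_scheme \<Rightarrow> ('k::field \<Rightarrow> 'a) \<Rightarrow> 'k poly \<Rightarrow> 'a \<Rightarrow> 'a" where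
  "alg_eval A \<phi> q x =
     (\<Oplus>\<^bsub>A\<^esub>i\<in>{..Polynomial.degree q}. \<phi> (Polynomial.coeff q i) \<otimes>\<^bsub>A\<^esub> (x [^]\<^bsub>A\<^esub> i))"

text \<open>The monic generator of the ideal of polynomials vanishing at \<open>x\<close>, or \<open>0\<close> if that ideal
  is zero.\<close>

definition min_poly ::
  "('a, 'm) ring_scheme \<Rightarrow> ('k::field \<Rightarrow> 'a) \<Rightarrow> 'a \<Rightarrow> 'k poly" where
  "min_poly A \<phi> x =
     (THE \<mu>. (\<mu> = 0 \<or> Polynomial.lead_coeff \<mu> = 1) \<and>
             (\<forall>q. alg_eval A \<phi> q x = \<zero>\<^bsub>A\<^esub> \<longleftrightarrow> \<mu> dvd q))"

text \<open>Pairwise distinct linear factors are indexed by the set \<open>Z\<close> of their roots; \<open>Z = {}\<close> gives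
  the non-zero constants.\<close>

definition separable_poly :: "('k::field) poly \<Rightarrow> bool" where
  "separable_poly q \<longleftrightarrow>
     (\<exists>c Z. c \<noteq> 0 \<and> finite Z \<and> map_poly to_ac q = Polynomial.smult c (\<Prod>a\<in>Z. [:- a, 1:]))"

definition sep_part :: "('k::field) poly \<Rightarrow> 'k alg_closure poly" where
  "sep_part q = (\<Prod>a | poly (map_poly to_ac q) a = 0. [:- a, 1:])"

definition separable_elements ::
  "('a, 'm) ring_scheme \<Rightarrow> ('k::field \<Rightarrow> 'a) \<Rightarrow> 'a set" where
  "separable_elements A \<phi> = {x \<in> carrier A. separable_poly (min_poly A \<phi> x)}"

text \<open>The extension \<open>\<iota> : K \<rightarrow> L\<close> is quasi-perfect for the \<open>K\<close>-algebra \<open>R\<close> with structure map \<open>\<phi>\<close>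
  if \<open>sep(\<mu>\<^sub>a) \<in> L[z]\<close> for all \<open>a \<in> R\<close>. The separable part is formed over the algebraic closure of
  \<open>L\<close>, which contains that of \<open>K\<close>. The definition by radicals staying radical in every extension
  field of \<open>L\<close> would quantify over types.\<close>

definition quasi_perfect ::
  "('k::field \<Rightarrow> 'l::field) \<Rightarrow> ('a, 'm) ring_scheme \<Rightarrow> ('k \<Rightarrow> 'a) \<Rightarrow> bool" where
  "quasi_perfect \<iota> R \<phi> \<longleftrightarrow>
     (\<forall>a \<in> carrier R. \<exists>q. map_poly to_ac q = sep_part (map_poly \<iota> (min_poly R \<phi> a)))"


subsection \<open>Tensor product of algebras\<close>

text \<open>For \<open>K\<close>-algebras \<open>A\<close>, \<open>B\<close> with structure maps \<open>\<alpha>\<close>, \<open>\<beta>\<close>, the ring \<open>A \<otimes>\<^sub>K B\<close> is the integral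
  monoid ring of the multiplicative monoid of \<open>A \<times> B\<close> (additively, the free abelian group on
  \<open>A \<times> B\<close>) modulo the bilinearity relations. The subgroup they generate is already an ideal,
  since multiplying a relation by a pair gives a relation again.\<close>

definition pair_ring ::
  "('a, 'm) ring_scheme \<Rightarrow> ('b, 'n) ring_scheme \<Rightarrow> (('a \<times> 'b) \<Rightarrow>\<^sub>0 int) ring" where
  "pair_ring A B =
     \<lparr>carrier = {u. Poly_Mapping.keys u \<subseteq> carrier A \<times> carrier B},
      monoid.mult = (\<lambda>u v. \<Sum>x\<in>Poly_Mapping.keys u. \<Sum>y\<in>Poly_Mapping.keys v.
        Poly_Mapping.single (fst x \<otimes>\<^bsub>A\<^esub> fst y, snd x \<otimes>\<^bsub>B\<^esub> snd y)
          (Poly_Mapping.lookup u x * Poly_Mapping.lookup v y)),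
      one = Poly_Mapping.single (\<one>\<^bsub>A\<^esub>, \<one>\<^bsub>B\<^esub>) 1,
      ring.zero = 0,
      add = (+)\<rparr>"

abbreviation pair_gen :: "'a \<Rightarrow> 'b \<Rightarrow> ('a \<times> 'b) \<Rightarrow>\<^sub>0 int" where
  "pair_gen a b \<equiv> Poly_Mapping.single (a, b) 1"

definition tensor_relations ::
  "('k \<Rightarrow> 'a) \<Rightarrow> ('a, 'm) ring_scheme \<Rightarrow> ('k \<Rightarrow> 'b) \<Rightarrow> ('b, 'n) ring_scheme
    \<Rightarrow> (('a \<times> 'b) \<Rightarrow>\<^sub>0 int) set" where
  "tensor_relations \<alpha> A \<beta> B =
     {pair_gen (a \<oplus>\<^bsub>A\<^esub> a') b - pair_gen a b - pair_gen a' b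
        | a a' b. a \<in> carrier A \<and> a' \<in> carrier A \<and> b \<in> carrier B} \<union>
     {pair_gen a (b \<oplus>\<^bsub>B\<^esub> b') - pair_gen a b - pair_gen a b'
        | a b b'. a \<in> carrier A \<and> b \<in> carrier B \<and> b' \<in> carrier B} \<union>
     {pair_gen (\<alpha> c \<otimes>\<^bsub>A\<^esub> a) b - pair_gen a (\<beta> c \<otimes>\<^bsub>B\<^esub> b)
        | c a b. a \<in> carrier A \<and> b \<in> carrier B}"

definition tensor_ideal ::
  "('k \<Rightarrow> 'a) \<Rightarrow> ('a, 'm) ring_scheme \<Rightarrow> ('k \<Rightarrow> 'b) \<Rightarrow> ('b, 'n) ring_scheme
    \<Rightarrow> (('a \<times> 'b) \<Rightarrow>\<^sub>0 int) set" where
  "tensor_ideal \<alpha> A \<beta> B = Idl\<^bsub>pair_ring A B\<^esub> (tensor_relations \<alpha> A \<beta> B)"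

definition tensor_product ::
  "('k \<Rightarrow> 'a) \<Rightarrow> ('a, 'm) ring_scheme \<Rightarrow> ('k \<Rightarrow> 'b) \<Rightarrow> ('b, 'n) ring_scheme
    \<Rightarrow> (('a \<times> 'b) \<Rightarrow>\<^sub>0 int) set ring" where
  "tensor_product \<alpha> A \<beta> B = pair_ring A B Quot tensor_ideal \<alpha> A \<beta> B"

definition pure_tensor ::
  "('k \<Rightarrow> 'a) \<Rightarrow> ('a, 'm) ring_scheme \<Rightarrow> ('k \<Rightarrow> 'b) \<Rightarrow> ('b, 'n) ring_scheme
    \<Rightarrow> 'a \<Rightarrow> 'b \<Rightarrow> (('a \<times> 'b) \<Rightarrow>\<^sub>0 int) set" where
  "pure_tensor \<alpha> A \<beta> B a b = tensor_ideal \<alpha> A \<beta> B +>\<^bsub>pair_ring A B\<^esub> pair_gen a b"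

end

theory Submission
  imports Defs "HOL-Algebra.Free_Abelian_Groups"
begin

text \<open>
  Write \<open>x\<^sup>a\<close> for the power product of a family \<open>x\<close> of units with exponents \<open>a \<in> \<int>\<^sup>k\<close>. Since
  \<open>g\<^sub>j = g\<^sub>j\<^sup>s\<^sup>e\<^sup>p h\<^sub>j\<close>, there is a splitting \<open>g\<^sup>a = G H\<close>, where \<open>G\<close> is the power product of the separable
  parts and \<open>H = h\<^sup>a\<close> lies in \<open>1 + Rad(0)\<close>. The exponent \<open>a\<close> belongs to all the lattices \<open>\<Lambda>\<^sub>i\<close> if and
  only if \<open>g\<^sup>a - 1\<close> lies in every maximal ideal, that is, in \<open>Rad(0)\<close>, and it belongs to \<open>M\<close> if and only
  if \<open>H = 1\<close>. So the theorem has two ingredients.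

  (1) The map \<open>R \<rightarrow> L \<otimes>\<^sub>K R\<close> is injective (\<open>field_extension_inj\<close>), so that \<open>f\<^sup>a = 1\<close> is equivalent to
  \<open>g\<^sup>a = 1\<close>. A \<open>K\<close>-linear retraction \<open>\<lambda> : L \<rightarrow> K\<close> induces an additive map with
  \<open>l \<otimes> r \<mapsto> \<lambda>(l) r\<close>, which is a left inverse.

  (2) A power product \<open>G\<close> of separable units with \<open>G - 1 \<in> Rad(0)\<close> equals \<open>1\<close>
  (\<open>separable_units_one\<close>). If \<open>g\<^sup>a = 1\<close>, then \<open>G = H\<^sup>-\<^sup>1 \<in> 1 + Rad(0)\<close>, hence \<open>G = 1\<close> and \<open>H = 1\<close>; if
  \<open>H = 1\<close> and \<open>g\<^sup>a - 1 \<in> Rad(0)\<close>, then \<open>G = g\<^sup>a \<in> 1 + Rad(0)\<close>, hence \<open>g\<^sup>a = G = 1\<close>.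

  For (2), let \<open>F\<close> be the algebraic closure of \<open>L\<close>. By (1) applied to the extension \<open>F\<close> of \<open>L\<close>, the
  ring \<open>S\<close> embeds into \<open>S' = F \<otimes>\<^sub>L S\<close>. There a separable element is killed by a product of distinct
  linear factors, in other words multiplication by it is diagonalizable. Commuting diagonalizable
  endomorphisms have diagonalizable products and inverses, so \<open>G\<close> acts diagonalizably as well. On the
  other hand an element \<open>w\<close> of the radical of \<open>S\<close> has no eigenvalue \<open>e \<noteq> 0\<close> on \<open>S'\<close>: some polynomial
  \<open>m\<close> over \<open>L\<close> satisfies \<open>m(e) = 0\<close> and \<open>m(0) \<noteq> 0\<close>, and \<open>m(w)\<close> is a unit of \<open>S\<close> because it differs
  from \<open>m(0)\<close> by an element of the radical, whereas \<open>m(w)\<close> kills the eigenvectors for \<open>e\<close>. So \<open>1\<close> is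
  the only eigenvalue of the diagonalizable \<open>G\<close>, and \<open>G = 1\<close>.\<close>

section \<open>Tensor products of algebras\<close>

lemma ring_of_type_algebra_simps [simp]:
  "carrier (ring_of_type_algebra :: 'a::comm_ring_1 ring) = UNIV"
  "x \<otimes>\<^bsub>(ring_of_type_algebra :: 'a ring)\<^esub> y = x * y"
  "x \<oplus>\<^bsub>(ring_of_type_algebra :: 'a ring)\<^esub> y = x + y"
  "\<one>\<^bsub>(ring_of_type_algebra :: 'a ring)\<^esub> = 1"
  "\<zero>\<^bsub>(ring_of_type_algebra :: 'a ring)\<^esub> = 0"
  by (simp_all add: ring_of_type_algebra_def)

lemma frag_cmul_single: "frag_cmul c (Poly_Mapping.single z d) = Poly_Mapping.single z (c * d)"
  by (rule poly_mapping_eqI) (simp add: lookup_single when_def)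

lemma frag_extend_fun_diff:
  "frag_extend (\<lambda>x. f x - g x) u = frag_extend f u - frag_extend g u"
proof -
  have "frag_cmul c (f x - g x) = frag_cmul c (f x) - frag_cmul c (g x)" for c x
    by (rule poly_mapping_eqI) (simp add: lookup_minus right_diff_distrib)
  then show ?thesis
    by (simp add: frag_extend_def sum_subtractf)
qed

lemma carrier_pair_ring:
  "u \<in> carrier (pair_ring A B) \<longleftrightarrow> Poly_Mapping.keys u \<subseteq> carrier A \<times> carrier B"
  by (simp add: pair_ring_def)

lemma pair_ring_simps [simp]:
  "u \<oplus>\<^bsub>pair_ring A B\<^esub> v = u + v"
  "\<zero>\<^bsub>pair_ring A B\<^esub> = 0"
  "\<one>\<^bsub>pair_ring A B\<^esub> = pair_gen \<one>\<^bsub>A\<^esub> \<one>\<^bsub>B\<^esub>"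
  by (simp_all add: pair_ring_def)

lemma pair_gen_in_carrier [simp]:
  "pair_gen a b \<in> carrier (pair_ring A B) \<longleftrightarrow> a \<in> carrier A \<and> b \<in> carrier B"
  by (simp add: carrier_pair_ring)

text \<open>The linear extension \<^const>\<open>frag_extend\<close> makes the biadditivity of the product visible.
  All ring axioms then reduce to identities between generators.\<close>

lemma pair_ring_mult:
  "u \<otimes>\<^bsub>pair_ring A B\<^esub> v =
     frag_extend (\<lambda>x. frag_extend (\<lambda>y. pair_gen (fst x \<otimes>\<^bsub>A\<^esub> fst y) (snd x \<otimes>\<^bsub>B\<^esub> snd y)) v) u"
  by (simp add: pair_ring_def frag_extend_def frag_cmul_sum frag_cmul_single)

lemma pair_gen_mult [simp]:
  "pair_gen a b \<otimes>\<^bsub>pair_ring A B\<^esub> pair_gen a' b' = pair_gen (a \<otimes>\<^bsub>A\<^esub> a') (b \<otimes>\<^bsub>B\<^esub> b')"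
  by (simp add: pair_ring_mult)

lemma pair_ring_mult_zero [simp]:
  "0 \<otimes>\<^bsub>pair_ring A B\<^esub> v = 0" "u \<otimes>\<^bsub>pair_ring A B\<^esub> 0 = 0"
  by (simp_all add: pair_ring_mult frag_extend_eq_0)

lemma pair_ring_mult_diff:
  "(u - u') \<otimes>\<^bsub>pair_ring A B\<^esub> v = u \<otimes>\<^bsub>pair_ring A B\<^esub> v - u' \<otimes>\<^bsub>pair_ring A B\<^esub> v"
  "u \<otimes>\<^bsub>pair_ring A B\<^esub> (v - v') = u \<otimes>\<^bsub>pair_ring A B\<^esub> v - u \<otimes>\<^bsub>pair_ring A B\<^esub> v'"
  by (simp_all add: pair_ring_mult frag_extend_diff frag_extend_fun_diff)

lemma pair_ring_induct [consumes 1, case_names zero gen diff]: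
  assumes "u \<in> carrier (pair_ring A B)" "P 0"
    and "\<And>a b. a \<in> carrier A \<Longrightarrow> b \<in> carrier B \<Longrightarrow> P (pair_gen a b)"
    and "\<And>v w. v \<in> carrier (pair_ring A B) \<Longrightarrow> w \<in> carrier (pair_ring A B) \<Longrightarrow> P v \<Longrightarrow> P w \<Longrightarrow> P (v - w)"
  shows "P u"
proof (rule free_Abelian_group_induct[where S = "carrier A \<times> carrier B"])
  show "P (frag_of x)" if "x \<in> carrier A \<times> carrier B" for x
    using that assms(3) by (cases x) auto
qed (use assms in \<open>auto simp: carrier_pair_ring\<close>)

lemma pair_ring_cring:
  assumes "cring A" "cring B"
  shows "cring (pair_ring A B)"
proof -
  interpret A: cring A by fact
  interpret B: cring B by fact
  have add: "u + v \<in> carrier (pair_ring A B)"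
    if "u \<in> carrier (pair_ring A B)" "v \<in> carrier (pair_ring A B)" for u v
    using that Poly_Mapping.keys_add[of u v] by (auto simp: carrier_pair_ring)
  have diff: "u - v \<in> carrier (pair_ring A B)"
    if "u \<in> carrier (pair_ring A B)" "v \<in> carrier (pair_ring A B)" for u v
    using that keys_diff[of u v] by (auto simp: carrier_pair_ring)
  have zero: "0 \<in> carrier (pair_ring A B)"
    by (simp add: carrier_pair_ring)
  show ?thesis
  proof (rule cringI)
    show "abelian_group (pair_ring A B)"
    proof (rule abelian_groupI)
      fix u assume "u \<in> carrier (pair_ring A B)"
      then show "\<exists>v\<in>carrier (pair_ring A B). v \<oplus>\<^bsub>pair_ring A B\<^esub> u = \<zero>\<^bsub>pair_ring A B\<^esub>"
        using diff[OF zero] by (intro bexI[of _ "0 - u"]) auto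
    qed (auto simp: add zero)
    show "comm_monoid (pair_ring A B)"
    proof (rule comm_monoidI)
      fix u v w
      assume u: "u \<in> carrier (pair_ring A B)" and v: "v \<in> carrier (pair_ring A B)"
      have gen: "pair_gen a b \<otimes>\<^bsub>pair_ring A B\<^esub> v \<in> carrier (pair_ring A B)"
        if "a \<in> carrier A" "b \<in> carrier B" for a b
        using v that by (induction v rule: pair_ring_induct) (auto simp: zero diff pair_ring_mult_diff)
      show "u \<otimes>\<^bsub>pair_ring A B\<^esub> v \<in> carrier (pair_ring A B)"
        using u by (induction u rule: pair_ring_induct) (auto simp: zero diff pair_ring_mult_diff gen)
      have gen: "pair_gen a b \<otimes>\<^bsub>pair_ring A B\<^esub> v = v \<otimes>\<^bsub>pair_ring A B\<^esub> pair_gen a b"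
        if "a \<in> carrier A" "b \<in> carrier B" for a b
        using v that by (induction v rule: pair_ring_induct)
          (auto simp: A.m_comm B.m_comm pair_ring_mult_diff)
      show "u \<otimes>\<^bsub>pair_ring A B\<^esub> v = v \<otimes>\<^bsub>pair_ring A B\<^esub> u"
        using u by (induction u rule: pair_ring_induct) (auto simp: pair_ring_mult_diff gen)
      assume w: "w \<in> carrier (pair_ring A B)"
      have gen1: "pair_gen a b \<otimes>\<^bsub>pair_ring A B\<^esub> pair_gen a' b' \<otimes>\<^bsub>pair_ring A B\<^esub> w
          = pair_gen a b \<otimes>\<^bsub>pair_ring A B\<^esub> (pair_gen a' b' \<otimes>\<^bsub>pair_ring A B\<^esub> w)"
        if "a \<in> carrier A" "b \<in> carrier B" "a' \<in> carrier A" "b' \<in> carrier B" for a b a' b'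
        using w that by (induction w rule: pair_ring_induct)
          (auto simp: A.m_assoc B.m_assoc pair_ring_mult_diff simp del: pair_gen_mult, simp_all add: A.m_assoc B.m_assoc)
      have gen2: "pair_gen a b \<otimes>\<^bsub>pair_ring A B\<^esub> v \<otimes>\<^bsub>pair_ring A B\<^esub> w
          = pair_gen a b \<otimes>\<^bsub>pair_ring A B\<^esub> (v \<otimes>\<^bsub>pair_ring A B\<^esub> w)"
        if "a \<in> carrier A" "b \<in> carrier B" for a b
        using v that by (induction v rule: pair_ring_induct)
          (auto simp: gen1 pair_ring_mult_diff simp del: pair_gen_mult)
      show "u \<otimes>\<^bsub>pair_ring A B\<^esub> v \<otimes>\<^bsub>pair_ring A B\<^esub> w
          = u \<otimes>\<^bsub>pair_ring A B\<^esub> (v \<otimes>\<^bsub>pair_ring A B\<^esub> w)"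
        using u by (induction u rule: pair_ring_induct) (auto simp: gen2 pair_ring_mult_diff)
    next
      fix u assume u: "u \<in> carrier (pair_ring A B)"
      then show "\<one>\<^bsub>pair_ring A B\<^esub> \<otimes>\<^bsub>pair_ring A B\<^esub> u = u"
        by (induction u rule: pair_ring_induct) (auto simp: pair_ring_mult_diff)
    qed auto
  next
    fix u v w
    \<comment> \<open>Sums are written as differences, because the induction rule for formal sums uses these.\<close>
    have "(u - (0 - v)) \<otimes>\<^bsub>pair_ring A B\<^esub> w
      = u \<otimes>\<^bsub>pair_ring A B\<^esub> w - (0 - v \<otimes>\<^bsub>pair_ring A B\<^esub> w)"
      by (simp only: pair_ring_mult_diff pair_ring_mult_zero)
    then show "(u \<oplus>\<^bsub>pair_ring A B\<^esub> v) \<otimes>\<^bsub>pair_ring A B\<^esub> w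
        = u \<otimes>\<^bsub>pair_ring A B\<^esub> w \<oplus>\<^bsub>pair_ring A B\<^esub> v \<otimes>\<^bsub>pair_ring A B\<^esub> w"
      by simp
  qed
qed

locale algebra_tensor = A: cring A + B: cring B
  for A :: "('a, 'm) ring_scheme" (structure) and B :: "('b, 'n) ring_scheme" (structure) +
  fixes \<alpha> :: "'k::field \<Rightarrow> 'a" and \<beta> :: "'k \<Rightarrow> 'b"
  assumes \<alpha>: "\<alpha> \<in> ring_hom ring_of_type_algebra A"
    and \<beta>: "\<beta> \<in> ring_hom ring_of_type_algebra B"
begin

abbreviation "T \<equiv> tensor_product \<alpha> A \<beta> B"

abbreviation "PR \<equiv> pair_ring A B"

sublocale P: cring PR
  by (rule pair_ring_cring) unfold_locales

lemma \<alpha>_closed [simp]: "\<alpha> c \<in> carrier A" and \<beta>_closed [simp]: "\<beta> c \<in> carrier B"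
  using ring_hom_closed[OF \<alpha>] ring_hom_closed[OF \<beta>] by auto

lemma diff_closed: "u \<in> carrier PR \<Longrightarrow> v \<in> carrier PR \<Longrightarrow> u - v \<in> carrier PR"
  using keys_diff[of u v] by (auto simp: carrier_pair_ring)

lemma minus_eq:
  assumes "u \<in> carrier PR" "v \<in> carrier PR"
  shows "u \<ominus>\<^bsub>PR\<^esub> v = u - v"
proof -
  have z: "0 \<in> carrier PR" by (simp add: carrier_pair_ring)
  have "u \<ominus>\<^bsub>PR\<^esub> v \<oplus>\<^bsub>PR\<^esub> v = u"
    using assms by (simp add: P.minus_eq P.a_assoc P.l_neg P.r_zero del: pair_ring_simps)
  then show ?thesis by (simp add: algebra_simps)
qed

lemma relations_subset: "tensor_relations \<alpha> A \<beta> B \<subseteq> carrier PR"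
  unfolding tensor_relations_def by (auto intro!: diff_closed)

lemma tensor_ideal: "ideal (tensor_ideal \<alpha> A \<beta> B) PR"
  unfolding tensor_ideal_def by (rule P.genideal_ideal[OF relations_subset])

lemma tensor_cring: "cring T"
  unfolding tensor_product_def by (rule ideal.quotient_is_cring[OF tensor_ideal P.is_cring])

lemma coset_hom: "(+>\<^bsub>PR\<^esub>) (tensor_ideal \<alpha> A \<beta> B) \<in> ring_hom PR T"
  unfolding tensor_product_def by (rule ideal.rcos_ring_hom[OF tensor_ideal])

lemma coset_eq_iff:
  assumes "u \<in> carrier PR" "v \<in> carrier PR"
  shows "tensor_ideal \<alpha> A \<beta> B +>\<^bsub>PR\<^esub> u = tensor_ideal \<alpha> A \<beta> B +>\<^bsub>PR\<^esub> v \<longleftrightarrow>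
    u - v \<in> tensor_ideal \<alpha> A \<beta> B"
  using P.quotient_eq_iff_same_a_r_cos[OF tensor_ideal assms] minus_eq[OF assms] by simp

lemma relation_in_ideal: "u \<in> tensor_relations \<alpha> A \<beta> B \<Longrightarrow> u \<in> tensor_ideal \<alpha> A \<beta> B"
  using P.genideal_self[OF relations_subset] by (auto simp: tensor_ideal_def)

lemma pure_tensor_closed:
  "a \<in> carrier A \<Longrightarrow> b \<in> carrier B \<Longrightarrow> pure_tensor \<alpha> A \<beta> B a b \<in> carrier T"
  unfolding pure_tensor_def by (rule ring_hom_closed[OF coset_hom]) simp

lemma pure_tensor_mult:
  assumes "a \<in> carrier A" "b \<in> carrier B" "a' \<in> carrier A" "b' \<in> carrier B"
  shows "pure_tensor \<alpha> A \<beta> B a b \<otimes>\<^bsub>T\<^esub> pure_tensor \<alpha> A \<beta> B a' b'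
    = pure_tensor \<alpha> A \<beta> B (a \<otimes>\<^bsub>A\<^esub> a') (b \<otimes>\<^bsub>B\<^esub> b')"
  unfolding pure_tensor_def using assms ring_hom_mult[OF coset_hom, of "pair_gen a b" "pair_gen a' b'"]
  by simp

lemma pure_tensor_add_left:
  assumes "a \<in> carrier A" "a' \<in> carrier A" "b \<in> carrier B"
  shows "pure_tensor \<alpha> A \<beta> B (a \<oplus>\<^bsub>A\<^esub> a') b
    = pure_tensor \<alpha> A \<beta> B a b \<oplus>\<^bsub>T\<^esub> pure_tensor \<alpha> A \<beta> B a' b"
proof -
  have "pair_gen (a \<oplus>\<^bsub>A\<^esub> a') b - pair_gen a b - pair_gen a' b \<in> tensor_relations \<alpha> A \<beta> B"
    unfolding tensor_relations_def using assms by blast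
  then show ?thesis
    unfolding pure_tensor_def using assms P.a_closed[of "pair_gen a b" "pair_gen a' b"]
    by (subst ring_hom_add[OF coset_hom, symmetric])
      (auto simp: coset_eq_iff diff_diff_eq dest: relation_in_ideal)
qed

lemma pure_tensor_add_right:
  assumes "a \<in> carrier A" "b \<in> carrier B" "b' \<in> carrier B"
  shows "pure_tensor \<alpha> A \<beta> B a (b \<oplus>\<^bsub>B\<^esub> b')
    = pure_tensor \<alpha> A \<beta> B a b \<oplus>\<^bsub>T\<^esub> pure_tensor \<alpha> A \<beta> B a b'"
proof -
  have "pair_gen a (b \<oplus>\<^bsub>B\<^esub> b') - pair_gen a b - pair_gen a b' \<in> tensor_relations \<alpha> A \<beta> B"
    unfolding tensor_relations_def using assms by blast
  then show ?thesis
    unfolding pure_tensor_def using assms P.a_closed[of "pair_gen a b" "pair_gen a b'"]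
    by (subst ring_hom_add[OF coset_hom, symmetric])
      (auto simp: coset_eq_iff diff_diff_eq dest: relation_in_ideal)
qed

lemma pure_tensor_balanced:
  "pure_tensor \<alpha> A \<beta> B (\<alpha> c) \<one>\<^bsub>B\<^esub> = pure_tensor \<alpha> A \<beta> B \<one>\<^bsub>A\<^esub> (\<beta> c)"
proof -
  have "pair_gen (\<alpha> c \<otimes>\<^bsub>A\<^esub> \<one>\<^bsub>A\<^esub>) \<one>\<^bsub>B\<^esub> - pair_gen \<one>\<^bsub>A\<^esub> (\<beta> c \<otimes>\<^bsub>B\<^esub> \<one>\<^bsub>B\<^esub>)
      \<in> tensor_relations \<alpha> A \<beta> B"
    unfolding tensor_relations_def by blast
  then show ?thesis
    unfolding pure_tensor_def
    by (auto simp: coset_eq_iff dest: relation_in_ideal)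
qed

lemma pure_tensor_one: "pure_tensor \<alpha> A \<beta> B \<one>\<^bsub>A\<^esub> \<one>\<^bsub>B\<^esub> = \<one>\<^bsub>T\<^esub>"
  unfolding pure_tensor_def using ring_hom_one[OF coset_hom] by simp

lemma left_hom: "(\<lambda>a. pure_tensor \<alpha> A \<beta> B a \<one>\<^bsub>B\<^esub>) \<in> ring_hom A T"
  by (rule ring_hom_memI)
    (auto simp: pure_tensor_closed pure_tensor_mult pure_tensor_add_left pure_tensor_one)

lemma right_hom: "(\<lambda>b. pure_tensor \<alpha> A \<beta> B \<one>\<^bsub>A\<^esub> b) \<in> ring_hom B T"
  by (rule ring_hom_memI)
    (auto simp: pure_tensor_closed pure_tensor_mult pure_tensor_add_right pure_tensor_one)

lemma relation_mult_gen:
  assumes "r \<in> tensor_relations \<alpha> A \<beta> B" "a \<in> carrier A" "b \<in> carrier B"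
  shows "r \<otimes>\<^bsub>PR\<^esub> pair_gen a b \<in> tensor_relations \<alpha> A \<beta> B"
  using assms(1) unfolding tensor_relations_def Un_iff
proof (elim disjE CollectE exE conjE, goal_cases)
  case (1 x x' y)
  show ?case
    apply (rule disjI1, rule disjI1, rule CollectI)
    apply (rule exI[of _ "x \<otimes>\<^bsub>A\<^esub> a"], rule exI[of _ "x' \<otimes>\<^bsub>A\<^esub> a"], rule exI[of _ "y \<otimes>\<^bsub>B\<^esub> b"])
    using 1 assms(2,3) by (simp add: pair_ring_mult_diff A.l_distr)
next
  case (2 x y y')
  show ?case
    apply (rule disjI1, rule disjI2, rule CollectI)
    apply (rule exI[of _ "x \<otimes>\<^bsub>A\<^esub> a"], rule exI[of _ "y \<otimes>\<^bsub>B\<^esub> b"], rule exI[of _ "y' \<otimes>\<^bsub>B\<^esub> b"])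
    using 2 assms(2,3) by (simp add: pair_ring_mult_diff B.l_distr)
next
  case (3 c x y)
  show ?case
    apply (rule disjI2, rule CollectI)
    apply (rule exI[of _ c], rule exI[of _ "x \<otimes>\<^bsub>A\<^esub> a"], rule exI[of _ "y \<otimes>\<^bsub>B\<^esub> b"])
    using 3 assms(2,3) by (simp add: pair_ring_mult_diff A.m_assoc B.m_assoc)
qed

text \<open>The tensor ideal is generated as an ideal, while a map out of the tensor product is only
  additive. The elements all of whose multiples are killed by \<open>h\<close> form an ideal; it contains the
  relations because a relation times a generator is again a relation.\<close>

lemma additive_vanishes_on_ideal:
  assumes closed: "\<And>u. u \<in> carrier PR \<Longrightarrow> h u \<in> carrier B"
    and diff: "\<And>u v. u \<in> carrier PR \<Longrightarrow> v \<in> carrier PR \<Longrightarrow> h (u - v) = h u \<ominus>\<^bsub>B\<^esub> h v"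
    and rel: "\<And>r. r \<in> tensor_relations \<alpha> A \<beta> B \<Longrightarrow> h r = \<zero>\<^bsub>B\<^esub>"
    and u: "u \<in> tensor_ideal \<alpha> A \<beta> B"
  shows "h u = \<zero>\<^bsub>B\<^esub>"
proof -
  define J where "J = {u \<in> carrier PR. \<forall>v\<in>carrier PR. h (u \<otimes>\<^bsub>PR\<^esub> v) = \<zero>\<^bsub>B\<^esub>}"
  have J_diff: "u - v \<in> J" if "u \<in> J" "v \<in> J" for u v
    using that by (auto simp: J_def diff_closed pair_ring_mult_diff diff B.minus_eq)
  have zero: "0 \<in> carrier PR" using P.zero_closed by simp
  have h0: "h 0 = \<zero>\<^bsub>B\<^esub>"
    using diff[OF zero zero] B.r_neg[OF closed[OF zero]] by (simp only: B.minus_eq diff_self)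
  have J0: "0 \<in> J" using zero h0 by (simp add: J_def)
  have "ideal J PR"
  proof (rule idealI)
    show "subgroup J (add_monoid PR)"
    proof (rule P.add.subgroupI)
      show "J \<subseteq> carrier PR" by (auto simp: J_def)
      show "J \<noteq> {}" using J0 by auto
      fix u assume u: "u \<in> J"
      have "\<ominus>\<^bsub>PR\<^esub> u = 0 - u"
        using u minus_eq[OF zero, of u] P.add.inv_closed[of u] by (simp add: J_def a_minus_def)
      then show "\<ominus>\<^bsub>PR\<^esub> u \<in> J" using J_diff[OF J0 u] by simp
      fix v assume "v \<in> J"
      then show "u \<oplus>\<^bsub>PR\<^esub> v \<in> J" using J_diff[OF u J_diff[OF J0, of v]] by simp
    qed
    fix a x assume a: "a \<in> J" and x: "x \<in> carrier PR"
    show ax: "a \<otimes>\<^bsub>PR\<^esub> x \<in> J"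
      using a x by (auto simp: J_def P.m_assoc)
    have "a \<in> carrier PR" using a by (simp add: J_def)
    then show "x \<otimes>\<^bsub>PR\<^esub> a \<in> J"
      using ax x P.m_comm[of x a] by metis
  qed (rule P.ring_axioms)
  moreover have "tensor_relations \<alpha> A \<beta> B \<subseteq> J"
  proof
    fix r assume r: "r \<in> tensor_relations \<alpha> A \<beta> B"
    have r': "r \<in> carrier PR" using r relations_subset by auto
    have "h (r \<otimes>\<^bsub>PR\<^esub> v) = \<zero>\<^bsub>B\<^esub>" if "v \<in> carrier PR" for v
      using that
    proof (induction v rule: pair_ring_induct)
      case (diff v w)
      then show ?case using r' by (simp add: pair_ring_mult_diff assms(2) B.minus_eq)
    qed (auto simp: h0 rel relation_mult_gen[OF r])
    then show "r \<in> J" using r' by (simp add: J_def)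
  qed
  ultimately have "tensor_ideal \<alpha> A \<beta> B \<subseteq> J"
    unfolding tensor_ideal_def by (rule P.genideal_minimal)
  then have "u \<in> J" using u by auto
  then have u: "u \<in> carrier PR" and "\<forall>v\<in>carrier PR. h (u \<otimes>\<^bsub>PR\<^esub> v) = \<zero>\<^bsub>B\<^esub>"
    unfolding J_def by simp_all
  from bspec[OF this(2) P.one_closed] show ?thesis
    unfolding P.r_one[OF u] .
qed

text \<open>For a module retraction \<open>ret\<close> of the structure map \<open>\<alpha>\<close>, the additive map
  \<open>a \<otimes> b \<mapsto> ret(a) b\<close> is a left inverse of \<open>b \<mapsto> 1 \<otimes> b\<close>.\<close>

lemma right_inj:
  assumes ret_add: "\<And>a a'. a \<in> carrier A \<Longrightarrow> a' \<in> carrier A \<Longrightarrow> ret (a \<oplus>\<^bsub>A\<^esub> a') = ret a + ret a'"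
    and ret_scale: "\<And>c a. a \<in> carrier A \<Longrightarrow> ret (\<alpha> c \<otimes>\<^bsub>A\<^esub> a) = c * ret a"
    and ret_one: "ret \<one>\<^bsub>A\<^esub> = 1"
  shows "inj_on (\<lambda>b. pure_tensor \<alpha> A \<beta> B \<one>\<^bsub>A\<^esub> b) (carrier B)"
proof -
  have "(\<lambda>(a, b). \<beta> (ret a) \<otimes>\<^bsub>B\<^esub> b) ` (carrier A \<times> carrier B) \<subseteq> carrier (add_monoid B)"
    by auto
  then obtain h where h: "h \<in> hom (free_Abelian_group (carrier A \<times> carrier B)) (add_monoid B)"
    and h_gen: "\<And>x. x \<in> carrier A \<times> carrier B \<Longrightarrow> h (frag_of x) = (\<lambda>(a, b). \<beta> (ret a) \<otimes>\<^bsub>B\<^esub> b) x"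
    using comm_group.free_Abelian_group_universal[OF B.a_comm_group] by metis
  have closed: "h u \<in> carrier B" if "u \<in> carrier PR" for u
    using hom_in_carrier[OF h, of u] that by (simp add: carrier_pair_ring)
  have add: "h (u + v) = h u \<oplus>\<^bsub>B\<^esub> h v" if "u \<in> carrier PR" "v \<in> carrier PR" for u v
    using hom_mult[OF h, of u v] that by (simp add: carrier_pair_ring)
  have diff: "h (u - v) = h u \<ominus>\<^bsub>B\<^esub> h v" if "u \<in> carrier PR" "v \<in> carrier PR" for u v
    using add[of "u - v" v] that diff_closed[of u v] closed[of v] closed[of "u - v"]
    by (simp add: B.minus_eq B.a_assoc B.r_neg)
  note \<beta>_hom = ring_hom_add[OF \<beta>, simplified] ring_hom_mult[OF \<beta>, simplified] ring_hom_one[OF \<beta>, simplified]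
  have cancel: "x \<oplus>\<^bsub>B\<^esub> y \<ominus>\<^bsub>B\<^esub> x \<ominus>\<^bsub>B\<^esub> y = \<zero>\<^bsub>B\<^esub>" if "x \<in> carrier B" "y \<in> carrier B" for x y
  proof -
    have "x \<oplus>\<^bsub>B\<^esub> y \<ominus>\<^bsub>B\<^esub> x = y"
      using that by (simp add: B.minus_eq B.a_comm[of x y] B.a_assoc B.r_neg)
    then show ?thesis using that by simp
  qed
  have rel: "h r = \<zero>\<^bsub>B\<^esub>" if "r \<in> tensor_relations \<alpha> A \<beta> B" for r
    using that unfolding tensor_relations_def Un_iff
  proof (elim disjE CollectE exE conjE, goal_cases)
    case (1 a a' b)
    then show ?case by (simp add: diff diff_closed h_gen ret_add \<beta>_hom B.l_distr cancel)
  next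
    case (2 a b b')
    then show ?case by (simp add: diff diff_closed h_gen B.r_distr cancel)
  next
    case (3 c a b)
    then have "\<beta> (c * ret a) \<otimes>\<^bsub>B\<^esub> b = \<beta> (ret a) \<otimes>\<^bsub>B\<^esub> (\<beta> c \<otimes>\<^bsub>B\<^esub> b)"
      by (simp add: \<beta>_hom B.m_ac)
    with 3 show ?case by (simp add: diff diff_closed h_gen ret_scale)
  qed
  show ?thesis
  proof (rule inj_onI)
    fix b b' assume b: "b \<in> carrier B" "b' \<in> carrier B"
      and "pure_tensor \<alpha> A \<beta> B \<one>\<^bsub>A\<^esub> b = pure_tensor \<alpha> A \<beta> B \<one>\<^bsub>A\<^esub> b'"
    then have "pair_gen \<one>\<^bsub>A\<^esub> b - pair_gen \<one>\<^bsub>A\<^esub> b' \<in> tensor_ideal \<alpha> A \<beta> B"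
      by (simp add: pure_tensor_def coset_eq_iff)
    then have "h (pair_gen \<one>\<^bsub>A\<^esub> b - pair_gen \<one>\<^bsub>A\<^esub> b') = \<zero>\<^bsub>B\<^esub>"
      using additive_vanishes_on_ideal[of h] closed diff rel by blast
    then show "b = b'"
      using b by (simp add: diff h_gen ret_one \<beta>_hom)
  qed
qed

end

text \<open>A basis of the extension field that contains \<open>1\<close> gives a linear retraction onto the base
  field.\<close>
lemma field_extension_retraction:
  fixes \<iota> :: "'k::field \<Rightarrow> 'l::field"
  assumes "\<iota> \<in> ring_hom ring_of_type_algebra ring_of_type_algebra"
  obtains ret where "\<And>x y. ret (x + y) = ret x + ret y" "\<And>c x. ret (\<iota> c * x) = c * ret x" "ret 1 = 1"
proof -
  have add: "\<iota> (x + y) = \<iota> x + \<iota> y" and mult: "\<iota> (x * y) = \<iota> x * \<iota> y" and one: "\<iota> 1 = 1" for x y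
    using ring_hom_add[OF assms] ring_hom_mult[OF assms] ring_hom_one[OF assms] by auto
  interpret vector_space_pair "\<lambda>c x. \<iota> c * x" "(*) :: 'k \<Rightarrow> 'k \<Rightarrow> 'k"
    by unfold_locales (auto simp: add mult one algebra_simps)
  have "vs1.independent {1}" by simp
  then obtain ret where "Vector_Spaces.linear (\<lambda>c x. \<iota> c * x) (*) ret" "ret 1 = 1"
    using linear_independent_extend[of "{1}" "\<lambda>_. 1"] by auto
  then interpret ret: Vector_Spaces.linear "\<lambda>c x. \<iota> c * x" "(*) :: 'k \<Rightarrow> 'k \<Rightarrow> 'k" ret
    by simp
  show ?thesis
    using that[of ret] ret.add ret.scale \<open>ret 1 = 1\<close> by blast
qed

lemma field_extension_inj:
  fixes \<iota> :: "'k::field \<Rightarrow> 'l::field"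
  assumes \<iota>: "\<iota> \<in> ring_hom ring_of_type_algebra ring_of_type_algebra"
    and B: "cring B" and \<beta>: "\<beta> \<in> ring_hom ring_of_type_algebra B"
  shows "inj_on (\<lambda>b. pure_tensor \<iota> ring_of_type_algebra \<beta> B 1 b) (carrier B)"
proof -
  interpret algebra_tensor ring_of_type_algebra B \<iota> \<beta>
    using assms by (intro algebra_tensor.intro algebra_tensor_axioms.intro cring_from_type_algebra)
  obtain ret where "\<And>x y. ret (x + y) = ret x + ret y" "\<And>c x. ret (\<iota> c * x) = c * ret x" "ret 1 = 1"
    using field_extension_retraction[OF \<iota>] by blast
  then show ?thesis
    using right_inj[of ret] by simp
qed

section \<open>Evaluation of polynomials and diagonalizable elements\<close>

locale field_algebra = cring A
  for A :: "('a, 'm) ring_scheme" (structure) +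
  fixes \<phi> :: "'k::field \<Rightarrow> 'a"
  assumes \<phi>: "\<phi> \<in> ring_hom ring_of_type_algebra A"
begin

abbreviation "ev \<equiv> alg_eval A \<phi>"

lemma \<phi>_closed [simp]: "\<phi> c \<in> carrier A"
  using ring_hom_closed[OF \<phi>] by simp

lemma \<phi>_add: "\<phi> (c + d) = \<phi> c \<oplus> \<phi> d"
  and \<phi>_mult: "\<phi> (c * d) = \<phi> c \<otimes> \<phi> d"
  and \<phi>_one [simp]: "\<phi> 1 = \<one>"
  using ring_hom_add[OF \<phi>] ring_hom_mult[OF \<phi>] ring_hom_one[OF \<phi>] by auto

lemma \<phi>_zero [simp]: "\<phi> 0 = \<zero>"
  using ring_hom_zero[OF \<phi> ring_from_type_algebra ring_axioms] by simp

lemma \<phi>_uminus: "\<phi> (- c) = \<ominus> \<phi> c"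
  using \<phi>_add[of "- c" c] by (simp add: sum_zero_eq_neg)

lemma \<phi>_diff: "\<phi> (c - d) = \<phi> c \<ominus> \<phi> d"
  using \<phi>_add[of c "- d"] by (simp add: \<phi>_uminus a_minus_def)

lemma \<phi>_inverse: "c \<noteq> 0 \<Longrightarrow> \<phi> (inverse c) \<otimes> \<phi> c = \<one>"
  by (simp flip: \<phi>_mult)

lemma ev_0 [simp]: "ev 0 x = \<zero>" if "x \<in> carrier A"
  using that by (simp add: alg_eval_def)

lemma ev_pCons [simp]:
  assumes x: "x \<in> carrier A"
  shows "ev (pCons c q) x = \<phi> c \<oplus> x \<otimes> ev q x"
proof (cases "q = 0")
  case True
  then show ?thesis using x by (simp add: alg_eval_def)
next
  case False
  have "ev (pCons c q) x =
      (\<Oplus>i\<in>{..Polynomial.degree q}. \<phi> (Polynomial.coeff q i) \<otimes> (x [^] Suc i)) \<oplus> \<phi> c"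
  proof -
    have "ev (pCons c q) x =
        (\<Oplus>i\<in>{..Suc (Polynomial.degree q)}. \<phi> (Polynomial.coeff (pCons c q) i) \<otimes> x [^] i)"
      using False by (simp add: alg_eval_def)
    also have "\<dots> = (\<Oplus>i\<in>{..Polynomial.degree q}. \<phi> (Polynomial.coeff q i) \<otimes> (x [^] Suc i)) \<oplus> \<phi> c"
      using x by (subst add.finprod_Suc2) (simp_all add: Pi_def del: nat_pow_Suc)
    finally show ?thesis .
  qed
  also have "(\<Oplus>i\<in>{..Polynomial.degree q}. \<phi> (Polynomial.coeff q i) \<otimes> (x [^] Suc i))
      = (\<Oplus>i\<in>{..Polynomial.degree q}. x \<otimes> (\<phi> (Polynomial.coeff q i) \<otimes> x [^] i))"
    using x by (intro add.finprod_cong') (auto simp: m_ac)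
  also have "\<dots> = x \<otimes> ev q x"
    using x unfolding alg_eval_def by (subst finsum_rdistr) (auto simp: Pi_def)
  finally show ?thesis
    using x by (simp add: a_comm alg_eval_def)
qed

lemma ev_closed [simp]: "x \<in> carrier A \<Longrightarrow> ev q x \<in> carrier A"
  by (induction q) auto

lemma ev_add: "x \<in> carrier A \<Longrightarrow> ev (q + r) x = ev q x \<oplus> ev r x"
  by (induction q r rule: poly_induct2) (simp_all add: \<phi>_add r_distr a_ac)

lemma ev_smult: "x \<in> carrier A \<Longrightarrow> ev (Polynomial.smult c q) x = \<phi> c \<otimes> ev q x"
  by (induction q) (simp_all add: \<phi>_mult r_distr m_ac)

lemma ev_mult: "x \<in> carrier A \<Longrightarrow> ev (q * r) x = ev q x \<otimes> ev r x"
  by (induction q) (simp_all add: ev_add ev_smult l_distr m_assoc)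

lemma ev_diff_zero:
  assumes "x \<in> carrier A" "ev q x = \<zero>" "ev r x = \<zero>"
  shows "ev (q - r) x = \<zero>"
  using ev_add[of x q "- r"] ev_smult[of x "- 1" r] assms by simp

text \<open>The polynomials vanishing at \<open>x\<close> form an ideal, which is principal by division with
  remainder. This is what gives the definite description in \<^const>\<open>min_poly\<close> a meaning; the zero
  polynomial is the generator if \<open>x\<close> is not algebraic.\<close>

lemma min_poly_exists:
  assumes x: "x \<in> carrier A"
  shows "\<exists>!\<mu>. (\<mu> = 0 \<or> Polynomial.lead_coeff \<mu> = 1) \<and> (\<forall>q. ev q x = \<zero> \<longleftrightarrow> \<mu> dvd q)"
proof (rule ex_ex1I)
  have "\<exists>\<mu>. (\<mu> = 0 \<or> Polynomial.lead_coeff \<mu> = 1) \<and> ev \<mu> x = \<zero> \<and> (\<forall>q. ev q x = \<zero> \<longrightarrow> \<mu> dvd q)"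
  proof (cases "\<exists>q. q \<noteq> 0 \<and> ev q x = \<zero>")
    case False
    then show ?thesis using x by (intro exI[of _ 0]) auto
  next
    case True
    define r where "r = (ARG_MIN Polynomial.degree q. q \<noteq> 0 \<and> ev q x = \<zero>)"
    have r: "r \<noteq> 0" "ev r x = \<zero>"
      and min: "\<And>q. q \<noteq> 0 \<Longrightarrow> ev q x = \<zero> \<Longrightarrow> Polynomial.degree r \<le> Polynomial.degree q"
    proof -
      obtain q where q: "q \<noteq> 0 \<and> ev q x = \<zero>" using True by blast
      note arg_min_nat_lemma[of "\<lambda>q. q \<noteq> 0 \<and> ev q x = \<zero>", OF q, of Polynomial.degree]
      then show "r \<noteq> 0" "ev r x = \<zero>"
        "\<And>q. q \<noteq> 0 \<Longrightarrow> ev q x = \<zero> \<Longrightarrow> Polynomial.degree r \<le> Polynomial.degree q"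
        unfolding r_def by simp_all
    qed
    have dvd: "r dvd q" if q: "ev q x = \<zero>" for q
    proof (rule ccontr)
      assume "\<not> r dvd q"
      then have "q mod r \<noteq> 0" by (simp add: dvd_eq_mod_eq_0)
      moreover have "ev (q mod r) x = \<zero>"
        using ev_diff_zero[OF x q, of "q div r * r"] r x by (simp add: ev_mult minus_div_mult_eq_mod)
      ultimately show False
        using min[of "q mod r"] degree_mod_less'[OF r(1), of q] by simp
    qed
    define c where "c = inverse (Polynomial.lead_coeff r)"
    have c: "c \<noteq> 0" "c * Polynomial.lead_coeff r = 1" using r by (simp_all add: c_def)
    have "ev (Polynomial.smult c r) x = \<zero>" using r(2) x by (simp add: ev_smult)
    moreover have "Polynomial.smult c r dvd q" if "ev q x = \<zero>" for q
      using dvd[OF that] c(1) by (simp add: smult_dvd_iff)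
    ultimately show ?thesis
      using c by (intro exI[of _ "Polynomial.smult c r"]) simp
  qed
  then obtain \<mu> where \<mu>: "\<mu> = 0 \<or> Polynomial.lead_coeff \<mu> = 1" "ev \<mu> x = \<zero>"
    "\<And>q. ev q x = \<zero> \<Longrightarrow> \<mu> dvd q" by blast
  moreover have "ev q x = \<zero>" if "\<mu> dvd q" for q
    using that \<mu>(2) x by (auto simp: ev_mult)
  ultimately show "\<exists>\<mu>. (\<mu> = 0 \<or> Polynomial.lead_coeff \<mu> = 1) \<and> (\<forall>q. ev q x = \<zero> \<longleftrightarrow> \<mu> dvd q)"
    by (intro exI[of _ \<mu>] conjI allI iffI)
next
  fix \<mu> \<nu> :: "'k poly"
  assume \<mu>: "(\<mu> = 0 \<or> Polynomial.lead_coeff \<mu> = 1) \<and> (\<forall>q. ev q x = \<zero> \<longleftrightarrow> \<mu> dvd q)"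
    and \<nu>: "(\<nu> = 0 \<or> Polynomial.lead_coeff \<nu> = 1) \<and> (\<forall>q. ev q x = \<zero> \<longleftrightarrow> \<nu> dvd q)"
  have "ev \<mu> x = \<zero>" "ev \<nu> x = \<zero>"
    using spec[OF conjunct2[OF \<mu>], of \<mu>] spec[OF conjunct2[OF \<nu>], of \<nu>] by simp_all
  then have dvd: "\<mu> dvd \<nu>" "\<nu> dvd \<mu>"
    using spec[OF conjunct2[OF \<mu>], of \<nu>] spec[OF conjunct2[OF \<nu>], of \<mu>] by simp_all
  show "\<mu> = \<nu>"
  proof (cases "\<mu> = 0 \<or> \<nu> = 0")
    case True
    then show ?thesis using dvd by auto
  next
    case False
    obtain s t where s: "\<nu> = \<mu> * s" and t: "\<mu> = \<nu> * t"
      using dvd unfolding dvd_def by blast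
    have "\<mu> * 1 = \<mu> * (s * t)" using t unfolding s mult.assoc mult_1_right .
    then have "1 = s * t" using False by (subst (asm) mult_left_cancel) auto
    then have "s dvd 1" by (rule dvdI)
    then obtain c where "s = [:c:]" by (auto simp: is_unit_poly_iff)
    moreover from this have "c = 1" using s \<mu> \<nu> False by simp
    ultimately show ?thesis using s by (simp add: one_pCons[symmetric])
  qed
qed

lemma ev_min_poly: "x \<in> carrier A \<Longrightarrow> ev (min_poly A \<phi> x) x = \<zero>"
  using spec[OF conjunct2[OF theI'[OF min_poly_exists]], of x "min_poly A \<phi> x"]
  by (simp add: min_poly_def)

lemma ev_eigen:
  assumes "x \<in> carrier A" "v \<in> carrier A" "x \<otimes> v = \<phi> a \<otimes> v"
  shows "ev q x \<otimes> v = \<phi> (poly q a) \<otimes> v"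
proof (induction q)
  case (pCons c q)
  have "x \<otimes> ev q x \<otimes> v = ev q x \<otimes> (x \<otimes> v)"
    using assms(1,2) by (simp add: m_ac)
  also have "\<dots> = \<phi> a \<otimes> (ev q x \<otimes> v)"
    unfolding assms(3) using assms(1,2) by (simp add: m_ac)
  finally show ?case
    using assms(1,2) pCons by (simp add: l_distr \<phi>_add \<phi>_mult m_assoc)
qed (use assms in simp)

text \<open>If the product of the distinct linear factors \<open>x - a\<close> kills \<open>u\<close>, then \<open>u\<close> is a sum of
  eigenvectors of \<open>x\<close>, so an element \<open>t\<close> that kills the eigenvectors kills \<open>u\<close>. Instead of the
  decomposition itself, the proof removes one factor at a time: for \<open>a \<noteq> b\<close>, the element
  \<open>(a - b) u\<close> is the difference of \<open>(x - b) u\<close> and \<open>(x - a) u\<close>, and each of these is killed by a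
  product with fewer factors.\<close>

lemma eigen_components:
  assumes fin: "finite Z" and x: "x \<in> carrier A" and t: "t \<in> carrier A"
    and eigen: "\<And>a v. a \<in> Z \<Longrightarrow> v \<in> carrier A \<Longrightarrow> x \<otimes> v = \<phi> a \<otimes> v \<Longrightarrow> t \<otimes> v = \<zero>"
    and u: "u \<in> carrier A" and kill: "ev (\<Prod>a\<in>Z. [:- a, 1:]) x \<otimes> u = \<zero>"
  shows "t \<otimes> u = \<zero>"
  using fin eigen u kill
proof (induction "card Z" arbitrary: Z u rule: less_induct)
  case less
  have lin: "ev [:- a, 1:] x = x \<ominus> \<phi> a" for a
    using x by (simp add: \<phi>_uminus a_minus_def a_comm)
  consider "Z = {}" | a where "Z = {a}" | a b where "a \<in> Z" "b \<in> Z" "a \<noteq> b"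
    by (metis all_not_in_conv insertI1 is_singletonI' is_singleton_def)
  then show ?case
  proof cases
    case 1
    then show ?thesis using less.prems x t by (simp add: one_pCons)
  next
    case (2 a)
    then have "(x \<ominus> \<phi> a) \<otimes> u = \<zero>" using less.prems by (simp add: lin)
    then have "x \<otimes> u \<ominus> \<phi> a \<otimes> u = \<zero>"
      using x less.prems(3) by (simp add: a_minus_def l_distr l_minus)
    then have "x \<otimes> u = \<phi> a \<otimes> u"
      using x less.prems(3) by simp
    then show ?thesis using less.prems 2 by auto
  next
    case (3 a b)
    have sub: "t \<otimes> ((x \<ominus> \<phi> c) \<otimes> u) = \<zero>" if c: "c \<in> Z" for c
    proof (rule less.hyps)
      show "card (Z - {c}) < card Z" using c less.prems(1) by (rule card_Diff1_less[rotated])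
      have "(\<Prod>a\<in>Z. [:- a, 1:]) = (\<Prod>a\<in>Z - {c}. [:- a, 1:]) * [:- c, 1:]"
        using c less.prems(1) by (simp add: prod.remove mult.commute)
      then have "ev (\<Prod>a\<in>Z. [:- a, 1:]) x = ev (\<Prod>a\<in>Z - {c}. [:- a, 1:]) x \<otimes> (x \<ominus> \<phi> c)"
        using x by (simp only: ev_mult lin)
      then show "ev (\<Prod>a\<in>Z - {c}. [:- a, 1:]) x \<otimes> ((x \<ominus> \<phi> c) \<otimes> u) = \<zero>"
        using less.prems(3,4) x by (simp add: m_assoc)
    qed (use less.prems x in auto)
    have diff: "\<phi> (a - b) = (x \<ominus> \<phi> b) \<oplus> \<ominus> (x \<ominus> \<phi> a)"
    proof -
      have "(x \<ominus> \<phi> b) \<oplus> \<ominus> (x \<ominus> \<phi> a) = (x \<oplus> \<ominus> \<phi> b) \<oplus> (\<ominus> x \<oplus> \<phi> a)"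
        using x by (simp add: a_minus_def minus_add)
      also have "\<dots> = (x \<oplus> \<ominus> x) \<oplus> (\<phi> a \<oplus> \<ominus> \<phi> b)"
        using x by (simp only: a_ac a_closed a_inv_closed \<phi>_closed)
      finally show ?thesis
        using x by (simp add: r_neg \<phi>_diff a_minus_def)
    qed
    have "\<phi> (a - b) \<otimes> (t \<otimes> u) = t \<otimes> (\<phi> (a - b) \<otimes> u)"
      using less.prems(3) t by (simp add: m_ac)
    also have "\<dots> = t \<otimes> ((x \<ominus> \<phi> b) \<otimes> u) \<oplus> \<ominus> (t \<otimes> ((x \<ominus> \<phi> a) \<otimes> u))"
      unfolding diff using less.prems(3) x t by (simp add: l_distr r_distr l_minus r_minus)
    also have "\<dots> = \<zero>" using sub[OF 3(1)] sub[OF 3(2)] by simp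
    finally have "\<phi> (inverse (a - b)) \<otimes> (\<phi> (a - b) \<otimes> (t \<otimes> u)) = \<zero>" by simp
    then show ?thesis
      using 3 less.prems(3) t by (simp add: \<phi>_inverse flip: m_assoc)
  qed
qed

text \<open>Over a splitting field of the minimal polynomial this is separability, phrased without
  minimal polynomials.\<close>

definition diagonalizable :: "'a \<Rightarrow> bool" where
  "diagonalizable x \<longleftrightarrow> x \<in> carrier A \<and> (\<exists>Z. finite Z \<and> ev (\<Prod>a\<in>Z. [:- a, 1:]) x = \<zero>)"

text \<open>The form in which diagonalizability is used: a statement \<open>t = 0\<close> may be tested on the
  eigenvectors of \<open>x\<close>.\<close>

lemma diagonalizableD:
  assumes "diagonalizable x"
  obtains Z where "finite Z"
    "\<And>t. t \<in> carrier A \<Longrightarrow> (\<And>a v. a \<in> Z \<Longrightarrow> v \<in> carrier A \<Longrightarrow> x \<otimes> v = \<phi> a \<otimes> v \<Longrightarrow> t \<otimes> v = \<zero>)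
      \<Longrightarrow> t = \<zero>"
proof -
  obtain Z where x: "x \<in> carrier A" and Z: "finite Z" "ev (\<Prod>a\<in>Z. [:- a, 1:]) x = \<zero>"
    using assms unfolding diagonalizable_def by blast
  have "t = \<zero>" if "t \<in> carrier A"
    "\<And>a v. a \<in> Z \<Longrightarrow> v \<in> carrier A \<Longrightarrow> x \<otimes> v = \<phi> a \<otimes> v \<Longrightarrow> t \<otimes> v = \<zero>" for t
    using eigen_components[OF Z(1) x that one_closed] Z(2) that(1) by simp
  then show ?thesis using that Z(1) by blast
qed

lemma diagonalizable_closed [simp]: "diagonalizable x \<Longrightarrow> x \<in> carrier A"
  by (simp add: diagonalizable_def)

lemma ev_linear_factors_eigen:
  assumes "x \<in> carrier A" "v \<in> carrier A" "x \<otimes> v = \<phi> a \<otimes> v" "a \<in> Z" "finite Z"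
  shows "ev (\<Prod>a\<in>Z. [:- a, 1:]) x \<otimes> v = \<zero>"
proof -
  have "poly (\<Prod>a\<in>Z. [:- a, 1:]) a = 0"
    using assms(4,5) by (auto simp: poly_prod)
  then show ?thesis using ev_eigen[OF assms(1-3)] assms(2) by simp
qed

lemma diagonalizable_one: "diagonalizable \<one>"
  unfolding diagonalizable_def by (auto intro!: exI[of _ "{1}"] simp: \<phi>_uminus l_neg)

text \<open>A product \<open>v w\<close> of eigenvectors of \<open>x\<close> and \<open>y\<close> is a common eigenvector of both, hence an
  eigenvector of \<open>x y\<close> whose eigenvalue is a product of eigenvalues.\<close>

lemma diagonalizable_mult:
  assumes x: "diagonalizable x" and y: "diagonalizable y"
  shows "diagonalizable (x \<otimes> y)"
proof -
  obtain Zx where Zx: "finite Zx" "\<And>t. t \<in> carrier A \<Longrightarrow>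
      (\<And>a v. a \<in> Zx \<Longrightarrow> v \<in> carrier A \<Longrightarrow> x \<otimes> v = \<phi> a \<otimes> v \<Longrightarrow> t \<otimes> v = \<zero>) \<Longrightarrow> t = \<zero>"
    by (rule diagonalizableD[OF x]) (rule that; blast)
  obtain Zy where Zy: "finite Zy" "\<And>t. t \<in> carrier A \<Longrightarrow>
      (\<And>a v. a \<in> Zy \<Longrightarrow> v \<in> carrier A \<Longrightarrow> y \<otimes> v = \<phi> a \<otimes> v \<Longrightarrow> t \<otimes> v = \<zero>) \<Longrightarrow> t = \<zero>"
    by (rule diagonalizableD[OF y]) (rule that; blast)
  \<comment> \<open>All possible eigenvalues of the product.\<close>
  define Z where "Z = (\<lambda>(a, b). a * b) ` (Zx \<times> Zy)"
  have Z: "finite Z" using Zx(1) Zy(1) by (simp add: Z_def)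
  define t where "t = ev (\<Prod>a\<in>Z. [:- a, 1:]) (x \<otimes> y)"
  have c: "x \<in> carrier A" "y \<in> carrier A" "t \<in> carrier A" using x y by (auto simp: t_def)
  have "t = \<zero>"
  proof (rule Zx(2))
    fix a v assume a: "a \<in> Zx" and v: "v \<in> carrier A" "x \<otimes> v = \<phi> a \<otimes> v"
    show "t \<otimes> v = \<zero>"
    proof (rule Zy(2))
      fix b w assume b: "b \<in> Zy" and w: "w \<in> carrier A" "y \<otimes> w = \<phi> b \<otimes> w"
      have "x \<otimes> y \<otimes> (v \<otimes> w) = (x \<otimes> v) \<otimes> (y \<otimes> w)"
        using c v(1) w(1) by (simp add: m_ac)
      also have "\<dots> = \<phi> (a * b) \<otimes> (v \<otimes> w)"
        unfolding v(2) w(2) using v(1) w(1) by (simp add: \<phi>_mult m_ac)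
      finally have "t \<otimes> (v \<otimes> w) = \<zero>"
        unfolding t_def using c v(1) w(1) a b Z
        by (intro ev_linear_factors_eigen[where a = "a * b"]) (auto simp: Z_def)
      then show "t \<otimes> v \<otimes> w = \<zero>" using c v(1) w(1) by (simp add: m_assoc)
    qed (use c v in auto)
  qed (use c in auto)
  then show ?thesis
    using Z c unfolding diagonalizable_def t_def by auto
qed

text \<open>The eigenvectors of \<open>x\<close> are those of its inverse, with inverse eigenvalues; the eigenvalue
  \<open>0\<close> of a unit has only the zero eigenvector, so it is harmless that the inverse of \<open>0\<close> is \<open>0\<close>.\<close>

lemma diagonalizable_inv:
  assumes x: "diagonalizable x" and unit: "x \<in> Units A"
  shows "diagonalizable (inv x)"
proof -
  obtain Zx where Zx: "finite Zx" "\<And>t. t \<in> carrier A \<Longrightarrow>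
      (\<And>a v. a \<in> Zx \<Longrightarrow> v \<in> carrier A \<Longrightarrow> x \<otimes> v = \<phi> a \<otimes> v \<Longrightarrow> t \<otimes> v = \<zero>) \<Longrightarrow> t = \<zero>"
    by (rule diagonalizableD[OF x]) (rule that; blast)
  define t where "t = ev (\<Prod>a\<in>inverse ` Zx. [:- a, 1:]) (inv x)"
  have c: "x \<in> carrier A" "inv x \<in> carrier A" "t \<in> carrier A"
    using x unit by (auto simp: t_def)
  have "t = \<zero>"
  proof (rule Zx(2))
    fix a v assume a: "a \<in> Zx" and v: "v \<in> carrier A" "x \<otimes> v = \<phi> a \<otimes> v"
    have v': "v = \<phi> a \<otimes> (inv x \<otimes> v)"
    proof -
      have "v = inv x \<otimes> (x \<otimes> v)" using unit c v(1) by (simp flip: m_assoc)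
      also have "\<dots> = \<phi> a \<otimes> (inv x \<otimes> v)" unfolding v(2) using c v(1) by (simp add: m_ac)
      finally show ?thesis .
    qed
    show "t \<otimes> v = \<zero>"
    proof (cases "a = 0")
      case True
      then have "v = \<zero>" using c v(1) v' by (metis \<phi>_zero l_null m_closed)
      then show ?thesis using c by simp
    next
      case False
      have "\<phi> (inverse a) \<otimes> v = \<phi> (inverse a) \<otimes> (\<phi> a \<otimes> (inv x \<otimes> v))"
        using v' by (rule arg_cong)
      also have "\<dots> = \<phi> (inverse a) \<otimes> \<phi> a \<otimes> (inv x \<otimes> v)"
        using c v(1) by (simp add: m_assoc)
      finally have "inv x \<otimes> v = \<phi> (inverse a) \<otimes> v"
        using False c v(1) by (simp add: \<phi>_inverse)
      then show ?thesis
        unfolding t_def using c v(1) a Zx(1)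
        by (intro ev_linear_factors_eigen[where a = "inverse a"]) auto
    qed
  qed (use c in auto)
  then show ?thesis
    using Zx(1) c unfolding diagonalizable_def t_def by auto
qed

lemma diagonalizable_eq_one:
  assumes x: "diagonalizable x"
    and eigen: "\<And>e v. e \<noteq> 0 \<Longrightarrow> v \<in> carrier A \<Longrightarrow> (x \<ominus> \<one>) \<otimes> v = \<phi> e \<otimes> v \<Longrightarrow> v = \<zero>"
  shows "x = \<one>"
proof -
  obtain Zx where Zx: "finite Zx" "\<And>t. t \<in> carrier A \<Longrightarrow>
      (\<And>a v. a \<in> Zx \<Longrightarrow> v \<in> carrier A \<Longrightarrow> x \<otimes> v = \<phi> a \<otimes> v \<Longrightarrow> t \<otimes> v = \<zero>) \<Longrightarrow> t = \<zero>"
    by (rule diagonalizableD[OF x]) (rule that; blast)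
  have "x \<ominus> \<one> = \<zero>"
  proof (rule Zx(2))
    fix a v assume a: "a \<in> Zx" and v: "v \<in> carrier A" "x \<otimes> v = \<phi> a \<otimes> v"
    have *: "(x \<ominus> \<one>) \<otimes> v = \<phi> (a - 1) \<otimes> v"
      using v x by (simp add: \<phi>_diff a_minus_def l_distr)
    show "(x \<ominus> \<one>) \<otimes> v = \<zero>"
    proof (cases "a = 1")
      case True
      then show ?thesis using * v by simp
    next
      case False
      then have "v = \<zero>" using eigen[OF _ v(1) *] by simp
      then show ?thesis using x by simp
    qed
  qed (use x in auto)
  then show ?thesis using x by simp
qed

end

lemma ev_ring_hom:
  assumes A: "field_algebra A \<phi>" and B: "field_algebra B \<psi>" and h: "h \<in> ring_hom A B"
    and comp: "\<And>c. h (\<phi> c) = \<psi> (\<iota> c)" and \<iota>0: "\<iota> 0 = 0" and x: "x \<in> carrier A"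
  shows "h (alg_eval A \<phi> q x) = alg_eval B \<psi> (map_poly \<iota> q) (h x)"
proof -
  interpret A: field_algebra A \<phi> by fact
  interpret B: field_algebra B \<psi> by fact
  have hx: "h x \<in> carrier B" using h x by (rule ring_hom_closed)
  show ?thesis
  proof (induction q)
    case 0
    have "h \<zero>\<^bsub>A\<^esub> = \<zero>\<^bsub>B\<^esub>" using comp[of 0] \<iota>0 by simp
    then show ?case using hx x by simp
  next
    case (pCons c q)
    then show ?case
      using x hx by (simp add: map_poly_pCons \<iota>0 ring_hom_add[OF h] ring_hom_mult[OF h] comp)
  qed
qed

section \<open>Units and the intersection of the maximal ideals\<close>

context cring
begin

text \<open>Krull's theorem, by Zorn's lemma.\<close>

lemma exists_maximalideal:
  assumes J: "ideal J R" "\<one> \<notin> J"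
  obtains M where "maximalideal M R" "J \<subseteq> M"
proof -
  define \<A> where "\<A> = {I. ideal I R \<and> J \<subseteq> I \<and> \<one> \<notin> I}"
  have "\<exists>M\<in>\<A>. \<forall>I\<in>\<A>. M \<subseteq> I \<longrightarrow> I = M"
  proof (rule subset_Zorn_nonempty)
    show "\<A> \<noteq> {}" using J by (auto simp: \<A>_def)
    fix C assume C: "C \<noteq> {}" "subset.chain \<A> C"
    then have "subset.chain {I. ideal I R} C"
      unfolding pred_on.chain_def \<A>_def by auto
    from chain_Union_is_ideal[OF this] have "ideal (\<Union>C) R"
      using C(1) by simp
    moreover have "C \<subseteq> \<A>" using C(2) by (simp add: pred_on.chain_def)
    then have "J \<subseteq> \<Union>C" "\<one> \<notin> \<Union>C"
      using C(1) by (auto simp: \<A>_def)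
    ultimately show "\<Union>C \<in> \<A>" by (simp add: \<A>_def)
  qed
  then obtain M where "M \<in> \<A>" and max: "\<forall>I\<in>\<A>. M \<subseteq> I \<longrightarrow> I = M"
    by (rule bexE)
  then have M: "ideal M R" "J \<subseteq> M" "\<one> \<notin> M" by (simp_all add: \<A>_def)
  have "maximalideal M R"
  proof (rule maximalidealI[OF M(1)])
    show "carrier R \<noteq> M" using M(3) by auto
    fix I assume I: "ideal I R" "M \<subseteq> I"
    show "I = M \<or> I = carrier R"
    proof (cases "\<one> \<in> I")
      case True
      then show ?thesis using ideal.one_imp_carrier[OF I(1)] by simp
    next
      case False
      then have "I \<in> \<A>" using I M(2) by (auto simp: \<A>_def)
      then show ?thesis using max I(2) by blast
    qed
  qed
  then show ?thesis using that M(2) by blast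
qed

lemma non_unit_in_maximalideal:
  assumes x: "x \<in> carrier R" "x \<notin> Units R"
  obtains M where "maximalideal M R" "x \<in> M"
proof -
  have "\<one> \<notin> PIdl x"
  proof
    assume "\<one> \<in> PIdl x"
    then obtain y where "y \<in> carrier R" "\<one> = y \<otimes> x" unfolding cgenideal_def by blast
    moreover from this have "\<one> = x \<otimes> y" using x(1) m_comm[of y x] by metis
    ultimately have "x \<in> Units R" using x(1) unfolding Units_def by fastforce
    then show False using x(2) by contradiction
  qed
  then show ?thesis
    using exists_maximalideal[OF cgenideal_ideal[OF x(1)]] cgenideal_self[OF x(1)] that by blast
qed

lemma zero_radical_closed: "r \<in> zero_radical R \<Longrightarrow> r \<in> carrier R"
  by (simp add: zero_radical_def)

lemma zero_radical_ideal: "ideal (zero_radical R) R"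
proof (rule idealI[OF ring_axioms])
  have id: "ideal M R" if "maximalideal M R" for M
    using that by (rule maximalideal.axioms)
  show "subgroup (zero_radical R) (add_monoid R)"
  proof (rule add.subgroupI)
    show "zero_radical R \<subseteq> carrier R" by (auto simp: zero_radical_def)
    show "zero_radical R \<noteq> {}"
      using zero_closed additive_subgroup.zero_closed[OF ideal.axioms(1)[OF id]]
      unfolding zero_radical_def by blast
    fix a b assume a: "a \<in> zero_radical R"
    then show "\<ominus> a \<in> zero_radical R"
      by (auto simp: zero_radical_def intro: additive_subgroup.a_inv_closed[OF ideal.axioms(1)[OF id]])
    assume "b \<in> zero_radical R"
    with a show "a \<oplus> b \<in> zero_radical R"
      by (auto simp: zero_radical_def intro: additive_subgroup.a_closed[OF ideal.axioms(1)[OF id]])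
  qed
  fix a x assume a: "a \<in> zero_radical R" "x \<in> carrier R"
  then show "x \<otimes> a \<in> zero_radical R"
    by (auto simp: zero_radical_def intro: ideal.I_l_closed[OF id])
  show "a \<otimes> x \<in> zero_radical R"
    using a by (auto simp: zero_radical_def intro: ideal.I_r_closed[OF id])
qed

text \<open>A maximal ideal that contains \<open>u + r\<close> contains \<open>r\<close>, and therefore the unit \<open>u\<close>.\<close>

lemma unit_add_radical:
  assumes u: "u \<in> Units R" and r: "r \<in> zero_radical R"
  shows "u \<oplus> r \<in> Units R"
proof (rule ccontr)
  assume "u \<oplus> r \<notin> Units R"
  moreover have carr: "u \<in> carrier R" "r \<in> carrier R" using u r by (auto dest: zero_radical_closed)
  ultimately obtain M where M: "maximalideal M R" "u \<oplus> r \<in> M"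
    using non_unit_in_maximalideal[of "u \<oplus> r"] by blast
  interpret M: maximalideal M R by (rule M(1))
  have "r \<in> M" using r M(1) by (simp add: zero_radical_def)
  then have "(u \<oplus> r) \<oplus> \<ominus> r \<in> M" using M(2) by simp
  then have "u \<in> M" using carr by (simp add: a_assoc r_neg)
  then have "inv u \<otimes> u \<in> M" using u by (intro M.I_l_closed) auto
  then have "\<one> \<in> M" using u by simp
  then show False using M.one_imp_carrier M.I_notcarr by simp
qed

lemma unit_of_radical_sum:
  assumes "c \<in> carrier R" "r \<in> zero_radical R" "c \<oplus> r \<in> Units R"
  shows "c \<in> Units R"
proof -
  have r: "r \<in> carrier R" using assms(2) by (rule zero_radical_closed)
  interpret Z: ideal "zero_radical R" R by (rule zero_radical_ideal)
  have "(c \<oplus> r) \<oplus> \<ominus> r \<in> Units R"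
    by (rule unit_add_radical) (use assms(2,3) in auto)
  moreover have "(c \<oplus> r) \<oplus> \<ominus> r = c" using assms(1) r by (simp add: a_assoc r_neg)
  ultimately show ?thesis by simp
qed

lemma in_one_plus_radical:
  "x \<in> carrier (one_plus_radical R) \<longleftrightarrow> x \<in> carrier R \<and> x \<ominus> \<one> \<in> zero_radical R"
proof
  assume "x \<in> carrier (one_plus_radical R)"
  then obtain r where r: "r \<in> zero_radical R" "x = \<one> \<oplus> r"
    by (auto simp: one_plus_radical_def)
  then have "x \<ominus> \<one> = r"
    using zero_radical_closed[OF r(1)] by (simp add: a_minus_def a_comm[of \<one> r] a_assoc r_neg)
  then show "x \<in> carrier R \<and> x \<ominus> \<one> \<in> zero_radical R"
    using r zero_radical_closed[OF r(1)] by simp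
next
  assume x: "x \<in> carrier R \<and> x \<ominus> \<one> \<in> zero_radical R"
  then have eq: "x = \<one> \<oplus> (x \<ominus> \<one>)"
    by (simp add: a_minus_def a_lcomm r_neg)
  have "x \<in> (\<lambda>r. \<one> \<oplus> r) ` zero_radical R"
    using eq conjunct2[OF x] by (rule image_eqI)
  then show "x \<in> carrier (one_plus_radical R)"
    by (simp add: one_plus_radical_def)
qed

lemma one_plus_radical_subgroup:
  "subgroup (carrier (one_plus_radical R)) (units_of R)"
proof -
  interpret U: comm_group "units_of R" by (rule units_comm_group)
  interpret Z: ideal "zero_radical R" R by (rule zero_radical_ideal)
  show ?thesis
  proof (rule U.subgroupI)
    show sub: "carrier (one_plus_radical R) \<subseteq> carrier (units_of R)"
      using unit_add_radical[OF Units_one_closed] by (auto simp: one_plus_radical_def units_of_carrier)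
    have "\<one> \<in> carrier (one_plus_radical R)" by (simp add: in_one_plus_radical a_minus_def r_neg)
    then show "carrier (one_plus_radical R) \<noteq> {}" by blast
    fix x y assume x: "x \<in> carrier (one_plus_radical R)"
    then have xu: "x \<in> Units R" and xr: "x \<ominus> \<one> \<in> zero_radical R"
      using sub by (auto simp: units_of_carrier in_one_plus_radical)
    have "inv x \<ominus> \<one> = (\<ominus> (inv x)) \<otimes> (x \<ominus> \<one>)"
      using xu Units_closed[OF xu] by (simp add: a_minus_def r_distr l_minus r_minus minus_add a_comm)
    also have "\<dots> \<in> zero_radical R"
      using xu xr by (intro Z.I_l_closed) auto
    finally show "inv\<^bsub>units_of R\<^esub> x \<in> carrier (one_plus_radical R)"
      using xu by (simp add: units_of_inv in_one_plus_radical)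
    assume y: "y \<in> carrier (one_plus_radical R)"
    then have yc: "y \<in> carrier R" and yr: "y \<ominus> \<one> \<in> zero_radical R"
      by (auto simp: in_one_plus_radical)
    have "x \<otimes> y \<ominus> \<one> = x \<otimes> (y \<ominus> \<one>) \<oplus> (x \<ominus> \<one>)"
      using Units_closed[OF xu] yc by (simp add: a_minus_def r_distr r_minus a_assoc r_neg1)
    also have "\<dots> \<in> zero_radical R"
      using Units_closed[OF xu] xr yr by (intro Z.a_closed Z.I_l_closed) auto
    finally show "x \<otimes>\<^bsub>units_of R\<^esub> y \<in> carrier (one_plus_radical R)"
      using Units_closed[OF xu] yc by (simp add: units_of_mult in_one_plus_radical)
  qed
qed

end

section \<open>Power products\<close>

abbreviation power_product :: "('a, 'm) monoid_scheme \<Rightarrow> nat \<Rightarrow> (nat \<Rightarrow> 'a) \<Rightarrow> (nat \<Rightarrow> int) \<Rightarrow> 'a" where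
  "power_product G k x a \<equiv> (\<Otimes>\<^bsub>G\<^esub>j\<in>{1..k}. x j [^]\<^bsub>G\<^esub> a j)"

lemma power_product_hom:
  assumes G: "comm_group G" and H: "comm_group H" and \<psi>: "\<psi> \<in> hom G H"
    and x: "\<And>j. j \<in> {1..k} \<Longrightarrow> x j \<in> carrier G"
    and y: "\<And>j. j \<in> {1..k} \<Longrightarrow> y j = \<psi> (x j)"
  shows "power_product H k y a = \<psi> (power_product G k x a)"
proof -
  interpret G: comm_group G by fact
  interpret H: comm_group H by fact
  interpret group_hom G H \<psi> using \<psi> by unfold_locales
  have "finite J \<Longrightarrow> J \<subseteq> {1..k} \<Longrightarrow>
      (\<Otimes>\<^bsub>H\<^esub>j\<in>J. y j [^]\<^bsub>H\<^esub> a j) = \<psi> (\<Otimes>\<^bsub>G\<^esub>j\<in>J. x j [^]\<^bsub>G\<^esub> a j)" for J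
    by (induction J rule: finite_induct) (auto simp: x y hom_int_pow Pi_def subset_iff)
  then show ?thesis by blast
qed

lemma (in comm_group) subgroup_comm_group:
  assumes "subgroup W G"
  shows "comm_group (G\<lparr>carrier := W\<rparr>)"
proof -
  interpret W: group "G\<lparr>carrier := W\<rparr>"
    by (rule subgroup.subgroup_is_group[OF assms group_axioms])
  show ?thesis
    by (rule W.group_comm_groupI) (use subgroup.subset[OF assms] in \<open>auto intro: m_comm\<close>)
qed

lemma (in comm_group) power_product_closed:
  assumes "subgroup W G" "\<And>j. j \<in> {1..k} \<Longrightarrow> x j \<in> W"
  shows "power_product G k x a \<in> W"
proof -
  interpret W: comm_group "G\<lparr>carrier := W\<rparr>"
    by (rule subgroup_comm_group[OF assms(1)])
  have "power_product G k x a = id (power_product (G\<lparr>carrier := W\<rparr>) k x a)"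
    by (rule power_product_hom[OF W.comm_group_axioms comm_group_axioms])
       (use assms subgroup.subset[OF assms(1)] in \<open>auto simp: hom_def\<close>)
  also have "\<dots> \<in> W"
    using W.finprod_closed[of "\<lambda>j. x j [^]\<^bsub>G\<lparr>carrier := W\<rparr>\<^esub> a j" "{1..k}"] W.int_pow_closed assms(2)
    by (simp add: Pi_def)
  finally show ?thesis .
qed

lemma units_of_hom:
  assumes "cring A" "cring B" "h \<in> ring_hom A B"
  shows "h \<in> hom (units_of A) (units_of B)"
proof (rule homI)
  interpret A: cring A by fact
  interpret B: cring B by fact
  fix x y assume x: "x \<in> carrier (units_of A)" and y: "y \<in> carrier (units_of A)"
  then have xu: "x \<in> Units A" and yu: "y \<in> Units A" by (auto simp: units_of_carrier)
  have "h x \<otimes>\<^bsub>B\<^esub> h (inv\<^bsub>A\<^esub> x) = \<one>\<^bsub>B\<^esub>" "h (inv\<^bsub>A\<^esub> x) \<otimes>\<^bsub>B\<^esub> h x = \<one>\<^bsub>B\<^esub>"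
    using xu by (simp_all add: ring_hom_one[OF assms(3)] A.Units_closed flip: ring_hom_mult[OF assms(3)])
  moreover have "h x \<in> carrier B" "h (inv\<^bsub>A\<^esub> x) \<in> carrier B"
    using xu by (auto intro!: ring_hom_closed[OF assms(3)] simp: A.Units_closed)
  ultimately show "h x \<in> carrier (units_of B)"
    unfolding units_of_carrier Units_def by blast
  show "h (x \<otimes>\<^bsub>units_of A\<^esub> y) = h x \<otimes>\<^bsub>units_of B\<^esub> h y"
    using xu yu by (simp add: units_of_mult ring_hom_mult[OF assms(3)] A.Units_closed)
qed

section \<open>Units that are separable\<close>

lemma to_ac_ring_hom: "to_ac \<in> ring_hom ring_of_type_algebra ring_of_type_algebra"
  by (rule ring_hom_memI) auto

context field_algebra
begin

abbreviation "A' \<equiv> tensor_product to_ac ring_of_type_algebra \<phi> A"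
abbreviation "emb \<equiv> pure_tensor to_ac ring_of_type_algebra \<phi> A 1"
abbreviation "scal \<equiv> (\<lambda>a. pure_tensor to_ac ring_of_type_algebra \<phi> A a \<one>)"

lemma closure_tensor: "algebra_tensor ring_of_type_algebra A to_ac \<phi>"
  using to_ac_ring_hom \<phi>
  by (intro algebra_tensor.intro algebra_tensor_axioms.intro cring_from_type_algebra is_cring)

lemma closure_algebra: "field_algebra A' scal"
  using algebra_tensor.tensor_cring[OF closure_tensor] algebra_tensor.left_hom[OF closure_tensor]
  by (intro field_algebra.intro field_algebra_axioms.intro)

lemma emb_hom: "emb \<in> ring_hom A A'"
  using algebra_tensor.right_hom[OF closure_tensor] by simp

lemma emb_inj: "inj_on emb (carrier A)"
  by (rule field_extension_inj[OF to_ac_ring_hom is_cring \<phi>])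

lemma emb_scal: "emb (\<phi> c) = scal (to_ac c)"
  using algebra_tensor.pure_tensor_balanced[OF closure_tensor, of c] by simp

lemma emb_ev: "x \<in> carrier A \<Longrightarrow> emb (ev q x) = alg_eval A' scal (map_poly to_ac q) (emb x)"
  by (rule ev_ring_hom[OF field_algebra_axioms closure_algebra emb_hom emb_scal]) simp_all

text \<open>Over the algebraic closure the minimal polynomial of a separable element is, up to a unit,
  the product of distinct linear factors required for diagonalizability.\<close>

lemma separable_imp_diagonalizable:
  assumes "x \<in> separable_elements A \<phi>"
  shows "field_algebra.diagonalizable A' scal (emb x)"
proof -
  interpret D: field_algebra A' scal by (rule closure_algebra)
  have x: "x \<in> carrier A" using assms by (simp add: separable_elements_def)
  then have x': "emb x \<in> carrier A'" by (rule ring_hom_closed[OF emb_hom])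
  obtain c Z where c: "c \<noteq> 0" and Z: "finite Z"
    and eq: "map_poly to_ac (min_poly A \<phi> x) = Polynomial.smult c (\<Prod>a\<in>Z. [:- a, 1:])"
    using assms by (auto simp: separable_elements_def separable_poly_def)
  define t where "t = D.ev (\<Prod>a\<in>Z. [:- a, 1:]) (emb x)"
  have t: "t \<in> carrier A'" using x' by (simp add: t_def)
  have "emb \<zero> = \<zero>\<^bsub>A'\<^esub>"
    by (rule ring_hom_zero[OF emb_hom ring_axioms D.ring_axioms])
  then have "scal c \<otimes>\<^bsub>A'\<^esub> t = \<zero>\<^bsub>A'\<^esub>"
    using emb_ev[OF x, of "min_poly A \<phi> x"] ev_min_poly[OF x] x' by (simp add: eq D.ev_smult t_def)
  then have "scal (inverse c) \<otimes>\<^bsub>A'\<^esub> (scal c \<otimes>\<^bsub>A'\<^esub> t) = \<zero>\<^bsub>A'\<^esub>"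
    by simp
  then have "t = \<zero>\<^bsub>A'\<^esub>"
    using t D.\<phi>_inverse[OF c] by (simp flip: D.m_assoc)
  then show ?thesis
    using x' Z unfolding D.diagonalizable_def t_def by blast
qed

text \<open>Dividing out powers of the variable makes the constant term non-zero.\<close>

lemma algebraic_nonzero_root:
  fixes e :: "'k alg_closure"
  assumes "e \<noteq> 0"
  obtains c q where "c \<noteq> 0" "poly (map_poly to_ac (pCons c q)) e = 0"
proof -
  obtain m :: "'k poly" where "m \<noteq> 0" "poly (map_poly to_ac m) e = 0"
    by (rule alg_closure_algebraic)
  then have "\<exists>c q. c \<noteq> 0 \<and> poly (map_poly to_ac (pCons c q)) e = 0"
  proof (induction m)
    case (pCons c m)
    then show ?case
    proof (cases "c = 0")
      case True
      with pCons show ?thesis using assms by (auto simp: map_poly_pCons)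
    qed blast
  qed simp
  then show ?thesis using that by blast
qed

text \<open>For a polynomial \<open>m\<close> over the base field with root \<open>e\<close> and non-zero constant term, \<open>m(w)\<close>
  is the sum of a unit and an element of the radical, hence a unit. On an eigenvector for \<open>e\<close> it acts
  as \<open>m(e) = 0\<close>.\<close>

lemma radical_no_nonzero_eigenvalue:
  assumes w: "w \<in> zero_radical A" and e: "e \<noteq> 0"
    and v: "v \<in> carrier A'" "emb w \<otimes>\<^bsub>A'\<^esub> v = scal e \<otimes>\<^bsub>A'\<^esub> v"
  shows "v = \<zero>\<^bsub>A'\<^esub>"
proof -
  interpret D: field_algebra A' scal by (rule closure_algebra)
  interpret Z: ideal "zero_radical A" A by (rule zero_radical_ideal)
  have wc: "w \<in> carrier A" using w by (rule zero_radical_closed)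
  then have w': "emb w \<in> carrier A'" by (rule ring_hom_closed[OF emb_hom])
  obtain c q where c: "c \<noteq> 0" and q: "poly (map_poly to_ac (pCons c q)) e = 0"
    using algebraic_nonzero_root[OF e] .
  have "\<phi> c \<in> Units A"
    using \<phi>_inverse[OF c] m_comm[of "\<phi> c" "\<phi> (inverse c)"] \<phi>_closed unfolding Units_def by fastforce
  then have unit: "ev (pCons c q) w \<in> Units A"
    using w wc by (simp add: unit_add_radical Z.I_r_closed)
  then have "emb (ev (pCons c q) w) \<in> Units A'"
    using hom_in_carrier[OF units_of_hom[OF is_cring D.is_cring emb_hom]] by (simp add: units_of_carrier)
  then have unit': "D.ev (map_poly to_ac (pCons c q)) (emb w) \<in> Units A'"
    using wc by (simp only: emb_ev)
  moreover have "D.ev (map_poly to_ac (pCons c q)) (emb w) \<otimes>\<^bsub>A'\<^esub> v = \<zero>\<^bsub>A'\<^esub>"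
    using D.ev_eigen[OF w' v, of "map_poly to_ac (pCons c q)"] v(1) unfolding q by simp
  ultimately show ?thesis
    using v(1) D.Units_l_cancel[of _ v "\<zero>\<^bsub>A'\<^esub>"] by (metis D.Units_closed D.r_null D.zero_closed)
qed

text \<open>After base change to the algebraic closure the power product is diagonalizable, and by
  \<open>radical_no_nonzero_eigenvalue\<close> its only eigenvalue is \<open>1\<close>.\<close>

lemma separable_units_one:
  assumes c: "\<And>j. j \<in> {1..k} \<Longrightarrow> c j \<in> Units A" "\<And>j. j \<in> {1..k} \<Longrightarrow> c j \<in> separable_elements A \<phi>"
    and radical: "power_product (units_of A) k c a \<ominus> \<one> \<in> zero_radical A"
  shows "power_product (units_of A) k c a = \<one>"
proof -
  interpret D: field_algebra A' scal by (rule closure_algebra)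
  interpret U: comm_group "units_of A" by (rule units_comm_group)
  \<comment> \<open>The units of \<open>A\<close> that become diagonalizable over the algebraic closure.\<close>
  define W where "W = {x \<in> Units A. D.diagonalizable (emb x)}"
  note emb_simps = ring_hom_mult[OF emb_hom] ring_hom_one[OF emb_hom] ring_hom_closed[OF emb_hom]
  have "subgroup W (units_of A)"
  proof (rule U.subgroupI)
    show "W \<subseteq> carrier (units_of A)" by (auto simp: W_def units_of_carrier)
    show "W \<noteq> {}" using D.diagonalizable_one by (auto simp: W_def emb_simps intro!: exI[of _ \<one>])
    fix x y assume x: "x \<in> W"
    then have xu: "x \<in> Units A" and xd: "D.diagonalizable (emb x)" by (auto simp: W_def)
    have ux: "emb x \<in> Units A'"
      using hom_in_carrier[OF units_of_hom[OF is_cring D.is_cring emb_hom]] xu by (simp add: units_of_carrier)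
    have "emb x \<otimes>\<^bsub>A'\<^esub> emb (inv x) = \<one>\<^bsub>A'\<^esub>"
      using xu by (simp add: Units_closed emb_simps flip: ring_hom_mult[OF emb_hom])
    then have "inv\<^bsub>A'\<^esub> (emb x) = emb (inv x)"
      using xu by (intro D.comm_inv_char) (auto simp: emb_simps Units_closed)
    then show "inv\<^bsub>units_of A\<^esub> x \<in> W"
      using xu D.diagonalizable_inv[OF xd ux] by (simp add: W_def units_of_inv)
    assume "y \<in> W"
    then show "x \<otimes>\<^bsub>units_of A\<^esub> y \<in> W"
      using xu xd D.diagonalizable_mult[OF xd] by (auto simp: W_def units_of_mult emb_simps Units_closed)
  qed
  moreover have "c j \<in> W" if "j \<in> {1..k}" for j
    using c that separable_imp_diagonalizable by (simp add: W_def)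
  ultimately have "power_product (units_of A) k c a \<in> W"
    by (rule U.power_product_closed)
  then have G: "power_product (units_of A) k c a \<in> carrier A"
    and diag: "D.diagonalizable (emb (power_product (units_of A) k c a))"
    by (auto simp: W_def)
  have "emb (power_product (units_of A) k c a \<ominus> \<one>) = emb (power_product (units_of A) k c a) \<ominus>\<^bsub>A'\<^esub> \<one>\<^bsub>A'\<^esub>"
  proof -
    interpret E: ring_hom_cring A A' emb
      using emb_hom by (intro ring_hom_cring.intro ring_hom_cring_axioms.intro is_cring D.is_cring)
    show ?thesis using G by (simp add: a_minus_def)
  qed
  then have "emb (power_product (units_of A) k c a) = \<one>\<^bsub>A'\<^esub>"
    using radical_no_nonzero_eigenvalue[OF radical] by (intro D.diagonalizable_eq_one[OF diag]) simp
  then show ?thesis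
    using G inj_onD[OF emb_inj] by (simp add: emb_simps)
qed

text \<open>With \<open>P\<close>, \<open>G\<close>, \<open>H\<close> the power products of \<open>c + r\<close>, \<open>c\<close> and \<open>h = 1 + r c\<^sup>-\<^sup>1\<close>, the identity
  \<open>P = G H\<close> with \<open>H \<in> 1 + Rad(0)\<close> shows that both sides of the equivalence put \<open>G\<close> into
  \<open>1 + Rad(0)\<close>, which forces \<open>G = 1\<close>.\<close>

lemma power_product_eq_one_iff:
  assumes c: "\<And>j. j \<in> {1..k} \<Longrightarrow> c j \<in> separable_elements A \<phi>"
    and r: "\<And>j. j \<in> {1..k} \<Longrightarrow> r j \<in> zero_radical A"
    and unit: "\<And>j. j \<in> {1..k} \<Longrightarrow> c j \<oplus> r j \<in> Units A"
  shows "power_product (units_of A) k (\<lambda>j. c j \<oplus> r j) a = \<one> \<longleftrightarrow>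
    power_product (units_of A) k (\<lambda>j. \<one> \<oplus> r j \<otimes> inv (c j)) a = \<one> \<and>
    power_product (units_of A) k (\<lambda>j. c j \<oplus> r j) a \<ominus> \<one> \<in> zero_radical A"
proof -
  interpret U: comm_group "units_of A" by (rule units_comm_group)
  interpret Z: ideal "zero_radical A" A by (rule zero_radical_ideal)
  define h where "h j = \<one> \<oplus> r j \<otimes> inv (c j)" for j
  let ?G = "power_product (units_of A) k c a" and ?H = "power_product (units_of A) k h a"
    and ?P = "power_product (units_of A) k (\<lambda>j. c j \<oplus> r j) a"
  have cu: "c j \<in> Units A" if "j \<in> {1..k}" for j
    using unit_of_radical_sum[of "c j" "r j"] c r unit that by (auto simp: separable_elements_def)
  have hr: "h j \<in> carrier (one_plus_radical A)" if "j \<in> {1..k}" for j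
    using cu[OF that] r[OF that] by (auto simp: one_plus_radical_def h_def intro!: Z.I_r_closed)
  have one_plus_units: "carrier (one_plus_radical A) \<subseteq> Units A"
    using subgroup.subset[OF one_plus_radical_subgroup] by (simp add: units_of_carrier)
  note pow_closed = U.int_pow_closed[unfolded units_of_carrier]
  have split: "c j \<oplus> r j = c j \<otimes> h j" if "j \<in> {1..k}" for j
  proof -
    have "c j \<otimes> (r j \<otimes> inv (c j)) = r j \<otimes> (c j \<otimes> inv (c j))"
      by (rule m_lcomm) (use cu[OF that] zero_radical_closed[OF r[OF that]] in auto)
    then show ?thesis
      using cu[OF that] zero_radical_closed[OF r[OF that]] by (simp add: h_def r_distr Units_closed)
  qed
  have "?P = power_product (units_of A) k (\<lambda>j. c j \<otimes>\<^bsub>units_of A\<^esub> h j) a"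
    using cu hr one_plus_units by (intro U.finprod_cong') (auto simp: split units_of_mult units_of_carrier subset_iff pow_closed)
  also have "\<dots> = (\<Otimes>\<^bsub>units_of A\<^esub>j\<in>{1..k}. c j [^]\<^bsub>units_of A\<^esub> a j \<otimes>\<^bsub>units_of A\<^esub> h j [^]\<^bsub>units_of A\<^esub> a j)"
    using cu hr one_plus_units
    by (intro U.finprod_cong') (auto simp: U.int_pow_distrib[unfolded units_of_carrier units_of_mult] units_of_carrier units_of_mult subset_iff Pi_def pow_closed)
  also have "\<dots> = ?G \<otimes>\<^bsub>units_of A\<^esub> ?H"
    using cu hr one_plus_units by (intro U.finprod_multf) (auto simp: units_of_carrier subset_iff pow_closed)
  finally have P: "?P = ?G \<otimes> ?H" by (simp add: units_of_mult)
  have H: "?H \<in> carrier (one_plus_radical A)"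
    using U.power_product_closed[OF one_plus_radical_subgroup hr] .
  then have HU: "?H \<in> Units A" using one_plus_units by blast
  have GU: "?G \<in> Units A"
    using U.power_product_closed[OF U.subgroup_self, of k c a] cu by (simp add: units_of_carrier)
  have G_one: "?G = \<one>" if "?G \<ominus> \<one> \<in> zero_radical A"
    using separable_units_one[OF cu c that] .
  show ?thesis
    unfolding h_def[symmetric]
  proof safe
    assume P1: "?P = \<one>"
    then have "?G = inv ?H"
      using P GU HU by (intro comm_inv_char[symmetric]) (auto simp: m_comm Units_closed)
    then have "?G = inv\<^bsub>units_of A\<^esub> ?H" using HU by (simp add: units_of_inv)
    then have "?G \<in> carrier (one_plus_radical A)"
      using subgroup.m_inv_closed[OF one_plus_radical_subgroup H] by simp
    then have "?G = \<one>" using G_one by (simp add: in_one_plus_radical)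
    then show "?H = \<one>" using P P1 HU by (simp add: Units_closed)
    show "?P \<ominus> \<one> \<in> zero_radical A" unfolding P1 by (simp add: a_minus_def r_neg)
  next
    assume "?H = \<one>" and P1: "?P \<ominus> \<one> \<in> zero_radical A"
    then have "?P = ?G" using P GU by (simp add: Units_closed)
    then show "?P = \<one>" using G_one P1 by simp
  qed
qed

end

section \<open>The exponent lattice\<close>

lemma mpoly_ring_cring: "cring (mpoly_ring n :: ('k::field) mpoly ring)"
proof -
  let ?P = "ring_of_type_algebra :: 'k mpoly ring"
  let ?H = "{q :: 'k mpoly. \<forall>m \<in> Poly_Mapping.keys q. Poly_Mapping.keys m \<subseteq> {1..n}}"
  interpret P: cring ?P by (rule cring_from_type_algebra)
  have minus: "\<ominus>\<^bsub>?P\<^esub> q = - q" for q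
    by (rule P.minus_equality) simp_all
  have "subring ?H ?P"
  proof (rule P.subringI)
    fix q r assume q: "q \<in> ?H" and r: "r \<in> ?H"
    have "Poly_Mapping.keys m \<subseteq> {1..n}" if m: "m \<in> Poly_Mapping.keys (q * r)" for m
    proof -
      obtain a b where "m = a + b" "a \<in> Poly_Mapping.keys q" "b \<in> Poly_Mapping.keys r"
        using m Poly_Mapping.keys_mult[of q r] by blast
      then show ?thesis using q r Poly_Mapping.keys_add[of a b] by fastforce
    qed
    then show "q \<otimes>\<^bsub>?P\<^esub> r \<in> ?H" by simp
    show "q \<oplus>\<^bsub>?P\<^esub> r \<in> ?H" using q r Poly_Mapping.keys_add[of q r] by auto
  qed (auto simp: minus)
  then have "subcring ?H ?P" by (rule P.subcringI')
  then show ?thesis unfolding mpoly_ring_def by (subst P.subcring_iff[symmetric]) auto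
qed

lemma quot_const_hom:
  assumes "ideal I (mpoly_ring n)"
  shows "quot_const n I \<in> ring_hom ring_of_type_algebra (mpoly_ring n Quot I)"
proof -
  have "(\<lambda>c. Poly_Mapping.single 0 c) \<in> ring_hom ring_of_type_algebra (mpoly_ring n)"
    by (rule ring_hom_memI) (auto simp: mpoly_ring_def mult_single single_add)
  from ring_hom_trans[OF this ideal.rcos_ring_hom[OF assms]] show ?thesis
    by (simp add: quot_const_def[abs_def] comp_def)
qed

theorem mainTheorem2:
  fixes p n k s :: nat
    and I :: "('k::field) mpoly set"
    and R :: "'k mpoly set ring"
    and f :: "nat \<Rightarrow> 'k mpoly set"
    and \<iota> :: "'k \<Rightarrow> 'l::field"
    and S :: "(('l \<times> 'k mpoly set) \<Rightarrow>\<^sub>0 int) set ring"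
    and emb_L :: "'l \<Rightarrow> (('l \<times> 'k mpoly set) \<Rightarrow>\<^sub>0 int) set"
    and emb_R :: "'k mpoly set \<Rightarrow> (('l \<times> 'k mpoly set) \<Rightarrow>\<^sub>0 int) set"
    and \<mm> :: "nat \<Rightarrow> (('l \<times> 'k mpoly set) \<Rightarrow>\<^sub>0 int) set set"
    and \<Lambda> :: "nat \<Rightarrow> (nat \<Rightarrow> int) set"
    and g gsep gnil h :: "nat \<Rightarrow> (('l \<times> 'k mpoly set) \<Rightarrow>\<^sub>0 int) set"
    and M :: "(nat \<Rightarrow> int) set"
  assumes char: "prime p" "CHAR('k) = p"
    and I: "ideal I (mpoly_ring n)"
    and R: "R = mpoly_ring n Quot I"
    and dim: "zero_dimensional R"
    and f: "\<forall>j\<in>{1..k}. f j \<in> Units R"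
    and \<iota>: "\<iota> \<in> ring_hom ring_of_type_algebra ring_of_type_algebra"
    and L: "quasi_perfect \<iota> R (quot_const n I)"
    and S: "S = tensor_product \<iota> ring_of_type_algebra (quot_const n I) R"
    and emb_L: "emb_L = (\<lambda>l. pure_tensor \<iota> ring_of_type_algebra (quot_const n I) R l \<one>\<^bsub>R\<^esub>)"
    and emb_R: "emb_R = (\<lambda>r. pure_tensor \<iota> ring_of_type_algebra (quot_const n I) R 1 r)"
    and \<mm>: "bij_betw \<mm> {1..s} {P. maximalideal P S}"
    and g: "\<forall>j\<in>{1..k}. g j = emb_R (f j)"
    and \<Lambda>: "\<forall>i\<in>{1..s}. \<Lambda> i =
               exponent_lattice (units_of (S Quot \<mm> i)) k (\<lambda>j. \<mm> i +>\<^bsub>S\<^esub> g j)"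
    and decomposition: "\<forall>j\<in>{1..k}. gsep j \<in> separable_elements S emb_L \<and>
               gnil j \<in> zero_radical S \<and> g j = gsep j \<oplus>\<^bsub>S\<^esub> gnil j"
    and h: "\<forall>j\<in>{1..k}. h j = \<one>\<^bsub>S\<^esub> \<oplus>\<^bsub>S\<^esub> gnil j \<otimes>\<^bsub>S\<^esub> inv\<^bsub>S\<^esub> gsep j"
    and M: "M = exponent_lattice (one_plus_radical S) k h"
  shows "M \<inter> (\<Inter>i\<in>{1..s}. \<Lambda> i) = exponent_lattice (units_of R) k f"
proof (rule Set.set_eqI)
  fix a :: "nat \<Rightarrow> int"
  interpret R: cring R
    unfolding R by (rule ideal.quotient_is_cring[OF I mpoly_ring_cring])
  have \<beta>: "quot_const n I \<in> ring_hom ring_of_type_algebra R"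
    unfolding R by (rule quot_const_hom[OF I])
  interpret T: algebra_tensor "ring_of_type_algebra :: 'l ring" R \<iota> "quot_const n I"
    using \<iota> \<beta> by (intro algebra_tensor.intro algebra_tensor_axioms.intro cring_from_type_algebra R.is_cring)
  interpret S: field_algebra S emb_L
    using T.tensor_cring T.left_hom unfolding S emb_L
    by (intro field_algebra.intro field_algebra_axioms.intro)
  have emb_R_hom: "emb_R \<in> ring_hom R S"
    using T.right_hom unfolding S emb_R by simp
  have emb_R_inj: "inj_on emb_R (carrier R)"
    unfolding emb_R by (rule field_extension_inj[OF \<iota> R.is_cring \<beta>])
  interpret UR: comm_group "units_of R" by (rule R.units_comm_group)
  interpret US: comm_group "units_of S" by (rule S.units_comm_group)
  have units_hom: "emb_R \<in> hom (units_of R) (units_of S)"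
    by (rule units_of_hom[OF R.is_cring S.is_cring emb_R_hom])
  let ?F = "power_product (units_of R) k f a" and ?P = "power_product (units_of S) k g a"
  have gU: "g j \<in> Units S" if "j \<in> {1..k}" for j
    using hom_in_carrier[OF units_hom] f g that by (simp add: units_of_carrier)
  have "?F \<in> Units R" and PU: "?P \<in> Units S"
    using UR.power_product_closed[OF UR.subgroup_self, of k f a] f
      US.power_product_closed[OF US.subgroup_self, of k g a] gU by (simp_all add: units_of_carrier)
  moreover have "?P = emb_R ?F"
    using f g by (intro power_product_hom[OF UR.comm_group_axioms US.comm_group_axioms units_hom])
      (auto simp: units_of_carrier)
  ultimately have lattice_R: "?F = \<one>\<^bsub>R\<^esub> \<longleftrightarrow> ?P = \<one>\<^bsub>S\<^esub>"
    using inj_on_eq_iff[OF emb_R_inj, of ?F "\<one>\<^bsub>R\<^esub>"] ring_hom_one[OF emb_R_hom] by auto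
  have lattice_\<Lambda>: "a \<in> \<Lambda> i \<longleftrightarrow> a \<in> {1..k} \<rightarrow>\<^sub>E UNIV \<and> ?P \<ominus>\<^bsub>S\<^esub> \<one>\<^bsub>S\<^esub> \<in> \<mm> i" if i: "i \<in> {1..s}" for i
  proof -
    have "maximalideal (\<mm> i) S" using \<mm> i by (auto simp: bij_betw_def)
    then have id: "ideal (\<mm> i) S" by (rule maximalideal.axioms)
    interpret Q: cring "S Quot \<mm> i" by (rule ideal.quotient_is_cring[OF id S.is_cring])
    have "power_product (units_of (S Quot \<mm> i)) k (\<lambda>j. \<mm> i +>\<^bsub>S\<^esub> g j) a = \<mm> i +>\<^bsub>S\<^esub> ?P"
      using gU by (intro power_product_hom[OF US.comm_group_axioms Q.units_comm_group
        units_of_hom[OF S.is_cring Q.is_cring ideal.rcos_ring_hom[OF id]]]) (auto simp: units_of_carrier)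
    moreover have "\<one>\<^bsub>S Quot \<mm> i\<^esub> = \<mm> i +>\<^bsub>S\<^esub> \<one>\<^bsub>S\<^esub>"
      by (simp add: FactRing_def)
    ultimately show ?thesis
      using S.quotient_eq_iff_same_a_r_cos[OF id, of ?P "\<one>\<^bsub>S\<^esub>"] PU \<Lambda> i
      by (simp add: exponent_lattice_def units_of_one S.Units_closed)
  qed
  have "?P \<ominus>\<^bsub>S\<^esub> \<one>\<^bsub>S\<^esub> \<in> zero_radical S \<longleftrightarrow> (\<forall>i\<in>{1..s}. ?P \<ominus>\<^bsub>S\<^esub> \<one>\<^bsub>S\<^esub> \<in> \<mm> i)"
  proof -
    have "maximalideal Q S \<longleftrightarrow> Q \<in> \<mm> ` {1..s}" for Q
      using \<mm> by (auto simp: bij_betw_def)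
    then show ?thesis using PU by (auto simp: zero_radical_def S.Units_closed)
  qed
  with lattice_\<Lambda> have lattice_\<Lambda>s: "a \<in> {1..k} \<rightarrow>\<^sub>E UNIV \<Longrightarrow>
      a \<in> (\<Inter>i\<in>{1..s}. \<Lambda> i) \<longleftrightarrow> ?P \<ominus>\<^bsub>S\<^esub> \<one>\<^bsub>S\<^esub> \<in> zero_radical S"
    by simp
  have cU: "gsep j \<in> Units S" if "j \<in> {1..k}" for j
    using S.unit_of_radical_sum[of "gsep j" "gnil j"] decomposition gU that
    by (auto simp: separable_elements_def)
  have h_rad: "h j \<in> carrier (one_plus_radical S)" if "j \<in> {1..k}" for j
    using h decomposition that cU[OF that] ideal.I_r_closed[OF S.zero_radical_ideal]
    by (auto simp: one_plus_radical_def)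
  have "one_plus_radical S = (units_of S)\<lparr>carrier := carrier (one_plus_radical S)\<rparr>"
    by (simp add: one_plus_radical_def)
  then have radical_group: "comm_group (one_plus_radical S)"
    using US.subgroup_comm_group[OF S.one_plus_radical_subgroup] by simp
  have id_hom: "id \<in> hom (one_plus_radical S) (units_of S)"
    using subgroup.subset[OF S.one_plus_radical_subgroup]
    by (auto simp: hom_def one_plus_radical_def)
  have "power_product (units_of S) k h a = id (power_product (one_plus_radical S) k h a)"
    using h_rad by (intro power_product_hom[OF radical_group US.comm_group_axioms id_hom]) auto
  then have lattice_M: "a \<in> M \<longleftrightarrow> a \<in> {1..k} \<rightarrow>\<^sub>E UNIV \<and> power_product (units_of S) k h a = \<one>\<^bsub>S\<^esub>"
    by (simp add: M exponent_lattice_def) (simp add: one_plus_radical_def units_of_one)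
  note pow_closed = US.int_pow_closed[unfolded units_of_carrier]
  have hU: "h j \<in> Units S" if "j \<in> {1..k}" for j
    using h_rad[OF that] subgroup.subset[OF S.one_plus_radical_subgroup] by (auto simp: units_of_carrier)
  have g_eq: "?P = power_product (units_of S) k (\<lambda>j. gsep j \<oplus>\<^bsub>S\<^esub> gnil j) a"
    by (rule US.finprod_cong')
      (use decomposition gU in \<open>auto simp: units_of_carrier pow_closed\<close>)
  have h_eq: "power_product (units_of S) k h a =
      power_product (units_of S) k (\<lambda>j. \<one>\<^bsub>S\<^esub> \<oplus>\<^bsub>S\<^esub> gnil j \<otimes>\<^bsub>S\<^esub> inv\<^bsub>S\<^esub> gsep j) a"
    by (rule US.finprod_cong') (use h hU in \<open>auto simp: units_of_carrier pow_closed\<close>)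
  have "?P = \<one>\<^bsub>S\<^esub> \<longleftrightarrow> power_product (units_of S) k h a = \<one>\<^bsub>S\<^esub> \<and> ?P \<ominus>\<^bsub>S\<^esub> \<one>\<^bsub>S\<^esub> \<in> zero_radical S"
    unfolding g_eq h_eq using decomposition gU by (intro S.power_product_eq_one_iff) auto
  then show "a \<in> M \<inter> (\<Inter>i\<in>{1..s}. \<Lambda> i) \<longleftrightarrow> a \<in> exponent_lattice (units_of R) k f"
    using lattice_M lattice_\<Lambda>s lattice_R
    by (auto simp: exponent_lattice_def units_of_one)
qed

end
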